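(* Let $N\ge1$ and suppose that $(a_n)_{n\ge0}$ (positive) and $(b_n)_{n\ge0}$ (real) are $N$-periodically modulated Jacobi parameters (with respect to $N$-periodic sequences $\alpha_n>0$, $\beta_n\in\mathbb{R}$, $n\in\mathbb{Z}$) such that $\mathfrak{X}_0(0)=\varepsilon\operatorname{Id}$ with $\varepsilon\in\{-1,1\}$. Assume that $$\Big(a_n\Big(\frac{\alpha_{n-1}}{\alpha_n}-\frac{a_{n-1}}{a_n}\Big):n\in\mathbb{N}\Big),\quad\Big(a_n\Big(\frac{\beta_n}{\alpha_n}-\frac{b_n}{a_n}\Big):n\in\mathbb{N}_0\Big),\quad\Big(\frac1{a_n}:n\in\mathbb{N}_0\Big)\in\mathcal{D}_1^N .$$ Set $$h(z)=\lim_{j\to\infty}a_{jN+N-1}^2\operatorname{discr}X_{jN}(z),\qquad z\in\mathbb{C}.$$ Then for each compact subset $K$ of $$\big\{z\in\mathbb{C}_+:h(z)\in\mathbb{C}\setminus(-\infty,0]\text{ and }\varepsilon\operatorname{Re}(h'(z))>0\big\}$$ there are $M\ge1$ and a basis of generalized eigenvectors $\{u^+(z),u^-(z)\}$ associated with $z\in K$ which are continuous on $K$ and holomorphic on $\operatorname{int}(K)$, such that for any $i_0\in\mathbb{N}_0$ the limits $$\varphi_{i_0}^+=\lim_{k\to\infty}\frac{u^+_{kN+i_0}}{\prod_{M\le j<k}\lambda_j^+}\quad\text{and}\quad\varphi_{i_0}^-=\lim_{k\to\infty}\frac{u^-_{kN+i_0}}{\prod_{M\le j<k}\lambda_j^-}$$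 exist uniformly on $K$, where $\lambda_j^\pm$ are the eigenvalues of $Y_j=X_{jN}$ specified in the context. Moreover, for all $z\in K$ and $i_0\in\{0,1,\dots,N-1\}$, $$|\varphi_{i_0}^+(z)|+|\varphi_{i_0+1}^+(z)|>0\quad\text{and}\quad|\varphi_{i_0}^-(z)|+|\varphi_{i_0+1}^-(z)|>0 .$$
   Context: $\mathbb{C}_+=\{z:\operatorname{Im}z>0\}$. A sequence $(x_n)$ belongs to $\mathcal{D}_1^N$ if $\sum_n|x_{n+N}-x_n|<\infty$. For a $2\times2$ matrix $X$, $\operatorname{discr}X=(\operatorname{tr}X)^2-4\det X$. (Under the hypotheses the limit $h$ exists and is a real polynomial of degree $2$ with negative leading coefficient.) The parameters are $N$-periodically modulated if $\frac{a_{n-1}}{a_n}-\frac{\alpha_{n-1}}{\alpha_n}\to0$, $\frac{b_n}{a_n}-\frac{\beta_n}{\alpha_n}\to0$ and $a_n\to\infty$. Put $\mathfrak{B}_j(x)=\begin{pmatrix}0&1\\-\frac{\alpha_{j-1}}{\alpha_j}&\frac{x-\beta_j}{\alpha_j}\end{pmatrix}$, $\mathfrak{X}_n=\mathfrak{B}_{n+N-1}\cdots\mathfrak{B}_n$ ($n\in\mathbb{Z}$); $B_j(x)=\begin{pmatrix}0&1\\-\frac{a_{j-1}}{a_j}&\frac{x-b_j}{a_j}\end{pmatrix}$ for $j\ge1$, $B_0(x)=\begin{pmatrix}0&1\\-\frac1{a_0}&\frac{x-b_0}{a_0}\end{pmatrix}$, $X_n=B_{n+N-1}\cdots B_n$.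 A generalized eigenvector associated with $z\in\mathbb{C}$ is a sequence $(u_n)_{n\ge0}$ such that for some $\eta\in\mathbb{C}^2\setminus\{0\}$ the vectors $\vec u_0=\eta$, $\vec u_n=(u_{n-1},u_n)^T$ ($n\ge1$) satisfy $\vec u_{n+1}=B_n(z)\vec u_n$ for all $n\ge0$. A basis means two linearly independent ones for each $z\in K$; continuity/holomorphy refers to each function $z\mapsto u_n^\pm(z)$. With $\sqrt{\cdot}$ the principal square root (argument in $(-\pi,\pi]$), let $\xi_\pm(w)=w\pm\sqrt{w-1}\sqrt{w+1}$, $w\in\mathbb{C}$ (so on $[-1,1]$, $\xi_+$ takes its boundary values from the upper half-plane). The eigenvalues of $Y_j(z)$ are $$\lambda_j^\pm(z)=\sqrt{\det Y_j(z)}\;\xi_\pm\Big(\frac{\operatorname{tr}Y_j(z)}{2\sqrt{\det Y_j(z)}}\Big).$$ *)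

theory Defs
  imports "HOL-Complex_Analysis.Complex_Analysis"
begin

definition bounded_variation_class :: "nat \<Rightarrow> (nat \<Rightarrow> real) \<Rightarrow> bool" where
  "bounded_variation_class N x \<longleftrightarrow> summable (\<lambda>n. \<bar>x (n + N) - x n\<bar>)"

definition discr :: "complex^2^2 \<Rightarrow> complex" where
  "discr X = (trace X)\<^sup>2 - 4 * det X"

text \<open>The product \<open>F (k - 1) ** \<dots> ** F 0\<close>, with later factors on the left.\<close>

primrec left_prod :: "(nat \<Rightarrow> complex^2^2) \<Rightarrow> nat \<Rightarrow> complex^2^2" where
  "left_prod F 0 = mat 1"
| "left_prod F (Suc k) = F k ** left_prod F k"

definition transfer_periodic :: "(int \<Rightarrow> real) \<Rightarrow> (int \<Rightarrow> real) \<Rightarrow> int \<Rightarrow> complex \<Rightarrow> complex^2^2" where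
  "transfer_periodic \<alpha> \<beta> j x =
     vector [vector [0, 1],
             vector [- of_real (\<alpha> (j - 1) / \<alpha> j), (x - of_real (\<beta> j)) / of_real (\<alpha> j)]]"

definition monodromy_periodic ::
    "(int \<Rightarrow> real) \<Rightarrow> (int \<Rightarrow> real) \<Rightarrow> nat \<Rightarrow> int \<Rightarrow> complex \<Rightarrow> complex^2^2" where
  "monodromy_periodic \<alpha> \<beta> N n x = left_prod (\<lambda>k. transfer_periodic \<alpha> \<beta> (n + int k) x) N"

text \<open>For \<open>j = 0\<close> the numerator \<open>a\<^sub>-\<^sub>1\<close> is taken to be 1.\<close>

definition transfer :: "(nat \<Rightarrow> real) \<Rightarrow> (nat \<Rightarrow> real) \<Rightarrow> nat \<Rightarrow> complex \<Rightarrow> complex^2^2" where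
  "transfer a b j x =
     vector [vector [0, 1],
             vector [- of_real ((if j = 0 then 1 else a (j - 1)) / a j),
                     (x - of_real (b j)) / of_real (a j)]]"

definition monodromy ::
    "(nat \<Rightarrow> real) \<Rightarrow> (nat \<Rightarrow> real) \<Rightarrow> nat \<Rightarrow> nat \<Rightarrow> complex \<Rightarrow> complex^2^2" where
  "monodromy a b N n x = left_prod (\<lambda>k. transfer a b (n + k) x) N"

text \<open>The index is shifted by one in the limit where \<open>a\<^sub>n\<^sub>-\<^sub>1\<close> occurs,
  because \<open>n - 1\<close> truncates at 0.\<close>

definition periodically_modulated ::
    "nat \<Rightarrow> (int \<Rightarrow> real) \<Rightarrow> (int \<Rightarrow> real) \<Rightarrow> (nat \<Rightarrow> real) \<Rightarrow> (nat \<Rightarrow> real) \<Rightarrow> bool" where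
  "periodically_modulated N \<alpha> \<beta> a b \<longleftrightarrow>
     (\<forall>n. \<alpha> n > 0) \<and> (\<forall>n. \<alpha> (n + int N) = \<alpha> n) \<and> (\<forall>n. \<beta> (n + int N) = \<beta> n) \<and>
     (\<lambda>n. a n / a (Suc n) - \<alpha> (int n) / \<alpha> (int (Suc n))) \<longlonglongrightarrow> 0 \<and>
     (\<lambda>n. b n / a n - \<beta> (int n) / \<alpha> (int n)) \<longlonglongrightarrow> 0 \<and>
     filterlim a at_top sequentially"

definition limit_discr :: "(nat \<Rightarrow> real) \<Rightarrow> (nat \<Rightarrow> real) \<Rightarrow> nat \<Rightarrow> complex \<Rightarrow> complex" where
  "limit_discr a b N z =
     lim (\<lambda>j. (of_real (a (j * N + N - 1)))\<^sup>2 * discr (monodromy a b N (j * N) z))"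

definition gen_eigenvector ::
    "(nat \<Rightarrow> real) \<Rightarrow> (nat \<Rightarrow> real) \<Rightarrow> complex \<Rightarrow> (nat \<Rightarrow> complex) \<Rightarrow> bool" where
  "gen_eigenvector a b z u \<longleftrightarrow>
     (\<exists>\<eta> :: complex^2. \<eta> \<noteq> 0 \<and>
        (let v = (\<lambda>n. if n = 0 then \<eta> else vector [u (n - 1), u n])
         in \<forall>n. v (Suc n) = transfer a b n z *v v n))"

definition lin_indep_seqs :: "(nat \<Rightarrow> complex) \<Rightarrow> (nat \<Rightarrow> complex) \<Rightarrow> bool" where
  "lin_indep_seqs u v \<longleftrightarrow>
     (\<forall>c d. (\<forall>n. c * u n + d * v n = 0) \<longrightarrow> c = 0 \<and> d = 0)"

text \<open>A sequence of functions is written \<open>u n z\<close>, with the index first.\<close>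

definition gen_eigenvector_basis_on ::
    "(nat \<Rightarrow> real) \<Rightarrow> (nat \<Rightarrow> real) \<Rightarrow> complex set \<Rightarrow>
     (nat \<Rightarrow> complex \<Rightarrow> complex) \<Rightarrow> (nat \<Rightarrow> complex \<Rightarrow> complex) \<Rightarrow> bool" where
  "gen_eigenvector_basis_on a b K u v \<longleftrightarrow>
     (\<forall>z\<in>K. gen_eigenvector a b z (\<lambda>n. u n z) \<and> gen_eigenvector a b z (\<lambda>n. v n z) \<and>
            lin_indep_seqs (\<lambda>n. u n z) (\<lambda>n. v n z))"

text \<open>Here \<open>s\<close> is the sign \<open>1\<close> or \<open>-1\<close> selecting the branch. The product of two roots must not
  be merged into one root of \<open>w\<^sup>2 - 1\<close>: the branch cuts differ.\<close>

definition xi :: "complex \<Rightarrow> complex \<Rightarrow> complex" where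
  "xi s w = w + s * (csqrt (w - 1) * csqrt (w + 1))"

definition eigenval ::
    "(nat \<Rightarrow> real) \<Rightarrow> (nat \<Rightarrow> real) \<Rightarrow> nat \<Rightarrow> complex \<Rightarrow> nat \<Rightarrow> complex \<Rightarrow> complex" where
  "eigenval a b N s j z =
     (let Y = monodromy a b N (j * N) z
      in csqrt (det Y) * xi s (trace Y / (2 * csqrt (det Y))))"

end

theory Submission imports Defs
begin

text \<open>
Over one period the transfer matrices multiply to \<open>Y\<^sub>j = X\<^sub>j\<^sub>N(z)\<close>, and \<open>\<XX>\<^sub>0(0) = \<epsilon> Id\<close> makes this
a small perturbation of \<open>\<epsilon>\<close>: with \<open>A\<^sub>j = a\<^sub>j\<^sub>N\<^sub>+\<^sub>N\<^sub>-\<^sub>1\<close> one has \<open>Y\<^sub>j = \<epsilon> + R\<^sub>j / A\<^sub>j\<close>, where the hypotheses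
make the \<open>R\<^sub>j\<close> converge with summable increments, uniformly on compact sets
(\<open>bv_scaled_partial\<close>). The discriminant of \<open>R\<^sub>j\<close> is \<open>A\<^sub>j\<^sup>2 discr Y\<^sub>j\<close>, so it tends to \<open>h\<close>. The asymptotics
of the vectors \<open>u\<^sub>j\<^sub>N\<close> then come from diagonalising \<open>R\<^sub>j\<close> and treating the motion of the eigenvectors as a
summable perturbation, as in Levinson's theorem. Three facts make this possible on \<open>K\<close>.

First, \<open>h\<close> avoids the cut, so the principal root of the discriminant of \<open>R\<^sub>j\<close> eventually has real part
bounded below on \<open>K\<close>. Hence the eigenvalues of \<open>R\<^sub>j\<close> are separated, and
\<open>\<bar>\<lambda>\<^sub>j\<^sup>- / \<lambda>\<^sub>j\<^sup>+\<bar> \<le> 1 - c / A\<^sub>j\<close> (\<open>eigenvalue_ratio_bounds\<close>). That it is \<open>\<lambda>\<^sub>j\<^sup>+\<close> which dominates depends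
on the branch in the definition of \<open>\<xi>\<^sub>\<plusminus>\<close>, and is decided by the sign of \<open>Re (\<surd>(w - 1) \<surd>(w + 1))\<close>
(\<open>Re_csqrt_mult_sign\<close>, \<open>eigenval_eq\<close>).

Second, the upper right entry of \<open>R\<^sub>j\<close> stays away from \<open>0\<close> in the upper half-plane, by the
Christoffel-Darboux identity (\<open>residual_12_lower_bound\<close>). So the eigenvectors can be written as
\<open>(1, m\<^sub>j\<^sup>\<plusminus>)\<close> with slopes that are holomorphic in \<open>z\<close> and of bounded variation in \<open>j\<close>, globally on \<open>K\<close>.

Third, both solutions of the resulting nearly diagonal system can be constructed explicitly and
uniformly in \<open>z\<close>: the dominant one by running forward (\<open>dominant_solution\<close>), the recessive one as a limit
of solutions that run backward from later and later indices (\<open>recessive_solution\<close>). Divided by the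
products of the eigenvalues, they have uniform limits that are linearly independent
(\<open>discrete_Levinson\<close>).

Since transfer matrices are invertible, these solutions extend to all indices, with the same regularity
in \<open>z\<close>; and since the transfer matrices at each position of a period converge, to invertible limits,
the asymptotics extend from the indices \<open>jN\<close> to all positions (\<open>block_asymptotics\<close>), where two
neighbouring limits never vanish together.
\<close>

(* The defining equation of csqrt would otherwise expand every principal root into real radicals. *)
declare csqrt.simps [simp del]

section \<open>Function sequences of uniformly bounded variation\<close>

text \<open>Bounded variation in the index, uniformly in the argument, is the form in which the \<open>\<D>\<^sub>1\<^sup>N\<close>
hypotheses are used: it is stable under the algebraic operations and it yields uniform limits. Only the
tail of the sequence is constrained, so that quantities such as inverses and square roots may be
formed although they are under control only from some index on.\<close>

definition unif_bv :: "complex set \<Rightarrow> (nat \<Rightarrow> complex \<Rightarrow> complex) \<Rightarrow> bool" where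
  "unif_bv K f \<longleftrightarrow> (\<exists>C G. summable G \<and>
     (\<forall>\<^sub>F n in sequentially. \<forall>z\<in>K. cmod (f n z) \<le> C \<and> cmod (f (Suc n) z - f n z) \<le> G n))"

lemma eventually_Suc_shift:
  "\<forall>\<^sub>F n in sequentially. P n \<Longrightarrow> \<forall>\<^sub>F n in sequentially. P (Suc n)"
  by (simp add: eventually_sequentially_Suc)

lemma unif_bvE:
  assumes "unif_bv K f"
  obtains C G where "C > 0" "summable G"
    "\<forall>\<^sub>F n in sequentially. \<forall>z\<in>K. cmod (f n z) \<le> C"
    "\<forall>\<^sub>F n in sequentially. \<forall>z\<in>K. cmod (f (Suc n) z) \<le> C"
    "\<forall>\<^sub>F n in sequentially. \<forall>z\<in>K. cmod (f (Suc n) z - f n z) \<le> G n"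
    "\<And>n. 0 \<le> G n"
proof (cases "K = {}")
  case True
  then show ?thesis by (intro that[of 1 "\<lambda>n. 0"]) auto
next
  case False
  obtain C G where CG: "summable G"
    "\<forall>\<^sub>F n in sequentially. \<forall>z\<in>K. cmod (f n z) \<le> C \<and> cmod (f (Suc n) z - f n z) \<le> G n"
    using assms unfolding unif_bv_def by blast
  have 1: "\<forall>\<^sub>F n in sequentially. \<forall>z\<in>K. cmod (f n z) \<le> max C 1"
    using CG(2) by eventually_elim (meson max.coboundedI1)
  have "\<forall>\<^sub>F n in sequentially. max 0 (G n) = G n"
    using CG(2)
  proof eventually_elim
    case (elim n)
    obtain z where "z \<in> K" using False by blast
    with elim have "0 \<le> G n" by (meson norm_ge_zero order_trans)
    then show ?case by simp
  qed
  then have G: "summable (\<lambda>n. max 0 (G n))"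
    using CG(1) summable_cong[of "\<lambda>n. max 0 (G n)" G] by blast
  have 3: "\<forall>\<^sub>F n in sequentially. \<forall>z\<in>K. cmod (f (Suc n) z - f n z) \<le> max 0 (G n)"
    using CG(2) by eventually_elim (meson max.coboundedI2)
  show ?thesis
    by (rule that[of "max C 1" "\<lambda>n. max 0 (G n)"]) (simp_all add: G 1 eventually_Suc_shift[OF 1] 3)
qed

lemma unif_bvI:
  assumes "summable G"
    "\<forall>\<^sub>F n in sequentially. \<forall>z\<in>K. cmod (f n z) \<le> C"
    "\<forall>\<^sub>F n in sequentially. \<forall>z\<in>K. cmod (f (Suc n) z - f n z) \<le> G n"
  shows "unif_bv K f"
  unfolding unif_bv_def
proof (intro exI conjI)
  show "summable G" by fact
  show "\<forall>\<^sub>F n in sequentially. \<forall>z\<in>K. cmod (f n z) \<le> C \<and> cmod (f (Suc n) z - f n z) \<le> G n"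
    using assms(2,3) by eventually_elim auto
qed

lemma unif_bv_const:
  assumes "\<And>z. z \<in> K \<Longrightarrow> cmod (c z) \<le> C"
  shows "unif_bv K (\<lambda>n. c)"
  by (rule unif_bvI[of "\<lambda>n. 0" K _ C]) (use assms in auto)

text \<open>This lets a sequence be studied after a shift of the index, which removes the exceptional role
of \<open>a\<^sub>-\<^sub>1\<close>.\<close>

lemma unif_bv_Suc_imp:
  assumes "unif_bv K (\<lambda>n. f (Suc n))"
  shows "unif_bv K f"
proof -
  obtain C G where CG: "C > 0" "summable G"
    "\<forall>\<^sub>F n in sequentially. \<forall>z\<in>K. cmod (f (Suc n) z) \<le> C"
    "\<forall>\<^sub>F n in sequentially. \<forall>z\<in>K. cmod (f (Suc (Suc n)) z) \<le> C"
    "\<forall>\<^sub>F n in sequentially. \<forall>z\<in>K. cmod (f (Suc (Suc n)) z - f (Suc n) z) \<le> G n"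
    using assms by (rule unif_bvE)
  show ?thesis
  proof (rule unif_bvI[of "\<lambda>n. G (n - 1)" K _ C])
    show "summable (\<lambda>n. G (n - 1))"
      by (rule summable_Suc_iff[THEN iffD1]) (use CG(2) in simp)
    show "\<forall>\<^sub>F n in sequentially. \<forall>z\<in>K. cmod (f n z) \<le> C"
      by (rule eventually_sequentially_Suc[THEN iffD1]) (use CG(3) in simp)
    show "\<forall>\<^sub>F n in sequentially. \<forall>z\<in>K. cmod (f (Suc n) z - f n z) \<le> G (n - 1)"
      by (rule eventually_sequentially_Suc[THEN iffD1]) (use CG(5) in simp)
  qed
qed

lemma unif_bv_add:
  assumes "unif_bv K f" "unif_bv K g"
  shows "unif_bv K (\<lambda>n z. f n z + g n z)"
proof -
  obtain C G where f: "C > 0" "summable G"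
    "\<forall>\<^sub>F n in sequentially. \<forall>z\<in>K. cmod (f n z) \<le> C"
    "\<forall>\<^sub>F n in sequentially. \<forall>z\<in>K. cmod (f (Suc n) z) \<le> C"
    "\<forall>\<^sub>F n in sequentially. \<forall>z\<in>K. cmod (f (Suc n) z - f n z) \<le> G n"
    using assms(1) by (rule unif_bvE)
  obtain C' G' where g: "C' > 0" "summable G'"
    "\<forall>\<^sub>F n in sequentially. \<forall>z\<in>K. cmod (g n z) \<le> C'"
    "\<forall>\<^sub>F n in sequentially. \<forall>z\<in>K. cmod (g (Suc n) z) \<le> C'"
    "\<forall>\<^sub>F n in sequentially. \<forall>z\<in>K. cmod (g (Suc n) z - g n z) \<le> G' n"
    using assms(2) by (rule unif_bvE)
  show ?thesis
  proof (rule unif_bvI[of "\<lambda>n. G n + G' n" K _ "C + C'"])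
    show "summable (\<lambda>n. G n + G' n)" using f(2) g(2) by (intro summable_add)
    show "\<forall>\<^sub>F n in sequentially. \<forall>z\<in>K. cmod (f n z + g n z) \<le> C + C'"
      using f(3) g(3) by eventually_elim (auto intro!: norm_triangle_mono)
    show "\<forall>\<^sub>F n in sequentially. \<forall>z\<in>K. cmod (f (Suc n) z + g (Suc n) z - (f n z + g n z)) \<le> G n + G' n"
      using f(5) g(5)
    proof eventually_elim
      case (elim n)
      show ?case
      proof
        fix z assume "z \<in> K"
        then show "cmod (f (Suc n) z + g (Suc n) z - (f n z + g n z)) \<le> G n + G' n"
          using norm_triangle_mono[of "f (Suc n) z - f n z" "G n" "g (Suc n) z - g n z" "G' n"] elim
          by (simp add: algebra_simps)
      qed
    qed
  qed
qed

lemma unif_bv_mult: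
  assumes "unif_bv K f" "unif_bv K g"
  shows "unif_bv K (\<lambda>n z. f n z * g n z)"
proof -
  obtain C G where f: "C > 0" "summable G"
    "\<forall>\<^sub>F n in sequentially. \<forall>z\<in>K. cmod (f n z) \<le> C"
    "\<forall>\<^sub>F n in sequentially. \<forall>z\<in>K. cmod (f (Suc n) z) \<le> C"
    "\<forall>\<^sub>F n in sequentially. \<forall>z\<in>K. cmod (f (Suc n) z - f n z) \<le> G n"
    using assms(1) by (rule unif_bvE)
  obtain C' G' where g: "C' > 0" "summable G'"
    "\<forall>\<^sub>F n in sequentially. \<forall>z\<in>K. cmod (g n z) \<le> C'"
    "\<forall>\<^sub>F n in sequentially. \<forall>z\<in>K. cmod (g (Suc n) z) \<le> C'"
    "\<forall>\<^sub>F n in sequentially. \<forall>z\<in>K. cmod (g (Suc n) z - g n z) \<le> G' n"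
    using assms(2) by (rule unif_bvE)
  show ?thesis
  proof (rule unif_bvI[of "\<lambda>n. C * G' n + G n * C'" K _ "C * C'"])
    show "summable (\<lambda>n. C * G' n + G n * C')"
      using f(2) g(2) by (intro summable_add summable_mult summable_mult2)
    show "\<forall>\<^sub>F n in sequentially. \<forall>z\<in>K. cmod (f n z * g n z) \<le> C * C'"
      using f(3) g(3) by eventually_elim (use f(1) g(1) in \<open>auto simp: norm_mult intro!: mult_mono\<close>)
    show "\<forall>\<^sub>F n in sequentially. \<forall>z\<in>K. cmod (f (Suc n) z * g (Suc n) z - f n z * g n z) \<le> C * G' n + G n * C'"
      using f(4,5) g(3,5)
    proof eventually_elim
      case (elim n)
      show ?case
      proof
        fix z assume z: "z \<in> K"
        have "f (Suc n) z * g (Suc n) z - f n z * g n z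
            = f (Suc n) z * (g (Suc n) z - g n z) + (f (Suc n) z - f n z) * g n z"
          by (simp add: algebra_simps)
        also have "cmod \<dots> \<le> C * G' n + G n * C'"
          using elim z f(1) order_trans[OF norm_ge_zero, of "f (Suc n) z - f n z" "G n"]
          by (intro norm_triangle_mono) (auto simp: norm_mult intro!: mult_mono)
        finally show "cmod (f (Suc n) z * g (Suc n) z - f n z * g n z) \<le> C * G' n + G n * C'" .
      qed
    qed
  qed
qed

lemma unif_bv_cmult: "unif_bv K f \<Longrightarrow> unif_bv K (\<lambda>n z. c * f n z)"
  by (intro unif_bv_mult unif_bv_const[of K _ "cmod c"]) auto

lemma unif_bv_diff:
  assumes "unif_bv K f" "unif_bv K g"
  shows "unif_bv K (\<lambda>n z. f n z - g n z)"
  using unif_bv_add[OF assms(1) unif_bv_cmult[OF assms(2), of "-1"]] by simp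

lemma unif_bv_inverse:
  assumes "unif_bv K f" "c > 0" "\<forall>\<^sub>F n in sequentially. \<forall>z\<in>K. c \<le> cmod (f n z)"
  shows "unif_bv K (\<lambda>n z. inverse (f n z))"
proof -
  obtain C G where f: "C > 0" "summable G"
    "\<forall>\<^sub>F n in sequentially. \<forall>z\<in>K. cmod (f n z) \<le> C"
    "\<forall>\<^sub>F n in sequentially. \<forall>z\<in>K. cmod (f (Suc n) z) \<le> C"
    "\<forall>\<^sub>F n in sequentially. \<forall>z\<in>K. cmod (f (Suc n) z - f n z) \<le> G n"
    using assms(1) by (rule unif_bvE)
  have S: "\<forall>\<^sub>F n in sequentially. \<forall>z\<in>K. c \<le> cmod (f (Suc n) z)"
    using assms(3) by (rule eventually_Suc_shift)
  show ?thesis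
  proof (rule unif_bvI[of "\<lambda>n. G n * inverse (c * c)" K _ "inverse c"])
    show "summable (\<lambda>n. G n * inverse (c * c))" using f by (intro summable_mult2)
    show "\<forall>\<^sub>F n in sequentially. \<forall>z\<in>K. cmod (inverse (f n z)) \<le> inverse c"
      using assms(3) by eventually_elim (use assms(2) in \<open>auto simp: norm_inverse intro!: le_imp_inverse_le\<close>)
    show "\<forall>\<^sub>F n in sequentially. \<forall>z\<in>K. cmod (inverse (f (Suc n) z) - inverse (f n z)) \<le> G n * inverse (c * c)"
      using f(5) assms(3) S
    proof eventually_elim
      case (elim n)
      show ?case
      proof
        fix z assume z: "z \<in> K"
        have ne: "f (Suc n) z \<noteq> 0" "f n z \<noteq> 0"
          using elim z assms(2) by (metis norm_zero not_le)+
        have "cmod (inverse (f (Suc n) z) - inverse (f n z))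
            = cmod (f (Suc n) z - f n z) * inverse (cmod (f (Suc n) z) * cmod (f n z))"
          using ne by (simp add: inverse_diff_inverse norm_mult norm_inverse norm_minus_commute mult_ac)
        also have "\<dots> \<le> G n * inverse (c * c)"
          using elim z assms(2) order_trans[OF norm_ge_zero, of "f (Suc n) z - f n z" "G n"]
          by (intro mult_mono le_imp_inverse_le) auto
        finally show "cmod (inverse (f (Suc n) z) - inverse (f n z)) \<le> G n * inverse (c * c)" .
      qed
    qed
  qed
qed

lemma Re_csqrt_nonneg: "0 \<le> Re (csqrt z)"
  using csqrt_principal[of z] by auto

lemma Re_csqrt_pos_iff: "0 < Re (csqrt z) \<longleftrightarrow> z \<notin> \<real>\<^sub>\<le>\<^sub>0"
proof -
  have "Re (csqrt z) = 0 \<longleftrightarrow> z \<in> \<real>\<^sub>\<le>\<^sub>0"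
  proof
    assume 0: "Re (csqrt z) = 0"
    have "(Complex 0 t)\<^sup>2 \<in> \<real>\<^sub>\<le>\<^sub>0" for t
      by (simp add: complex_nonpos_Reals_iff power2_eq_square)
    then show "z \<in> \<real>\<^sub>\<le>\<^sub>0"
      using 0 by (metis complex_surj power2_csqrt)
  next
    assume "z \<in> \<real>\<^sub>\<le>\<^sub>0"
    then show "Re (csqrt z) = 0" by (auto simp: complex_nonpos_Reals_iff cmod_eq_Re csqrt.simps)
  qed
  then show ?thesis using Re_csqrt_nonneg[of z] by linarith
qed

text \<open>Away from the cut the principal root is Lipschitz, because
\<open>x - y = (\<surd>x + \<surd>y) (\<surd>x - \<surd>y)\<close> and the first factor has real part at least \<open>c\<close>. A bound at one of
the two points is enough since principal roots never have negative real part; this is what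
transfers the distance from the cut from a limit to the sequence.\<close>

lemma csqrt_diff_le:
  assumes "c > 0" "c \<le> Re (csqrt x)"
  shows "cmod (csqrt x - csqrt y) \<le> cmod (x - y) / c"
proof -
  have "c \<le> Re (csqrt x + csqrt y)" using assms(2) Re_csqrt_nonneg[of y] by simp
  also have "\<dots> \<le> cmod (csqrt x + csqrt y)" by (rule complex_Re_le_cmod)
  finally have c: "c \<le> cmod (csqrt x + csqrt y)" .
  have "x - y = (csqrt x + csqrt y) * (csqrt x - csqrt y)"
    using power2_csqrt[of x] power2_csqrt[of y] by (simp add: algebra_simps power2_eq_square)
  then have "cmod (x - y) = cmod (csqrt x + csqrt y) * cmod (csqrt x - csqrt y)"
    by (simp add: norm_mult)
  also have "\<dots> \<ge> c * cmod (csqrt x - csqrt y)"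
    using c by (intro mult_right_mono) auto
  finally show ?thesis using assms(1) by (simp add: field_simps)
qed

lemma unif_bv_csqrt:
  assumes "unif_bv K f" "c > 0" "\<forall>\<^sub>F n in sequentially. \<forall>z\<in>K. c \<le> Re (csqrt (f n z))"
  shows "unif_bv K (\<lambda>n z. csqrt (f n z))"
proof -
  obtain C G where f: "C > 0" "summable G"
    "\<forall>\<^sub>F n in sequentially. \<forall>z\<in>K. cmod (f n z) \<le> C"
    "\<forall>\<^sub>F n in sequentially. \<forall>z\<in>K. cmod (f (Suc n) z) \<le> C"
    "\<forall>\<^sub>F n in sequentially. \<forall>z\<in>K. cmod (f (Suc n) z - f n z) \<le> G n"
    using assms(1) by (rule unif_bvE)
  have S: "\<forall>\<^sub>F n in sequentially. \<forall>z\<in>K. c \<le> Re (csqrt (f (Suc n) z))"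
    using assms(3) by (rule eventually_Suc_shift)
  show ?thesis
  proof (rule unif_bvI[of "\<lambda>n. G n / c" K _ "sqrt C"])
    show "summable (\<lambda>n. G n / c)" using f by (intro summable_divide)
    show "\<forall>\<^sub>F n in sequentially. \<forall>z\<in>K. cmod (csqrt (f n z)) \<le> sqrt C"
      using f(3) by eventually_elim auto
    show "\<forall>\<^sub>F n in sequentially. \<forall>z\<in>K. cmod (csqrt (f (Suc n) z) - csqrt (f n z)) \<le> G n / c"
      using f(5) S
    proof eventually_elim
      case (elim n)
      show ?case
        using elim assms(2) csqrt_diff_le[OF assms(2)]
        by (meson divide_right_mono less_imp_le order_trans)
    qed
  qed
qed

lemma unif_bv_uniform_limit:
  assumes "unif_bv K f"
  obtains l where "uniform_limit K f l sequentially" "bounded (l ` K)"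
proof -
  obtain C G where f: "C > 0" "summable G"
    "\<forall>\<^sub>F n in sequentially. \<forall>z\<in>K. cmod (f n z) \<le> C"
    "\<forall>\<^sub>F n in sequentially. \<forall>z\<in>K. cmod (f (Suc n) z) \<le> C"
    "\<forall>\<^sub>F n in sequentially. \<forall>z\<in>K. cmod (f (Suc n) z - f n z) \<le> G n"
    using assms by (rule unif_bvE)
  let ?S = "\<lambda>z. \<Sum>i. f (Suc i) z - f i z"
  have "uniform_limit K (\<lambda>n z. \<Sum>i<n. f (Suc i) z - f i z) ?S sequentially"
    using f(5,2) by (rule Weierstrass_m_test_ev)
  then have "uniform_limit K (\<lambda>n z. f 0 z + (\<Sum>i<n. f (Suc i) z - f i z)) (\<lambda>z. f 0 z + ?S z) sequentially"
    by (intro uniform_limit_intros)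
  then have lim: "uniform_limit K f (\<lambda>z. f 0 z + ?S z) sequentially"
    by (simp add: sum_lessThan_telescope[of "\<lambda>i. f i z" for z])
  have "cmod (f 0 z + ?S z) \<le> C" if "z \<in> K" for z
  proof (rule tendsto_upperbound)
    show "(\<lambda>n. cmod (f n z)) \<longlonglongrightarrow> cmod (f 0 z + ?S z)"
      using tendsto_uniform_limitI[OF lim that] by (rule tendsto_norm)
    show "\<forall>\<^sub>F n in sequentially. cmod (f n z) \<le> C"
      using f(3) by eventually_elim (use that in auto)
  qed simp
  then show ?thesis
    using that[OF lim] by (auto simp: bounded_iff)
qed

text \<open>Membership in \<open>\<D>\<^sub>1\<^sup>N\<close> is bounded variation along each residue class modulo \<open>N\<close>.\<close>

lemma unif_bv_subsequence:
  assumes "bounded_variation_class N x" "N \<ge> 1"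
  shows "unif_bv K (\<lambda>j z. of_real (x (j * N + i)))"
proof -
  let ?d = "\<lambda>j. \<bar>x (Suc j * N + i) - x (j * N + i)\<bar>"
  have "summable ((\<lambda>n. \<bar>x (n + N) - x n\<bar>) \<circ> (\<lambda>j. j * N + i))"
    using assms by (intro summable_reindex) (auto simp: bounded_variation_class_def inj_on_def)
  then have s: "summable ?d"
    by (simp add: o_def algebra_simps)
  have b: "\<bar>x (j * N + i)\<bar> \<le> \<bar>x i\<bar> + suminf ?d" for j
  proof -
    have "x (j * N + i) = x i + (\<Sum>l<j. x (Suc l * N + i) - x (l * N + i))"
      by (subst sum_lessThan_telescope) simp
    also have "\<bar>\<dots>\<bar> \<le> \<bar>x i\<bar> + (\<Sum>l<j. ?d l)"
      by (intro order_trans[OF abs_triangle_ineq] add_left_mono sum_abs)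
    also have "(\<Sum>l<j. ?d l) \<le> suminf ?d"
      using s by (intro sum_le_suminf) auto
    finally show ?thesis by simp
  qed
  show ?thesis
    by (rule unif_bvI[OF s, of _ _ "\<bar>x i\<bar> + suminf ?d"])
       (use b in \<open>auto simp flip: of_real_diff\<close>)
qed

section \<open>Continuous functions that are holomorphic in the interior\<close>

text \<open>The regularity that the basis has to have in the spectral parameter.\<close>

definition regular_on :: "complex set \<Rightarrow> (complex \<Rightarrow> complex) \<Rightarrow> bool" where
  "regular_on K f \<longleftrightarrow> continuous_on K f \<and> f holomorphic_on interior K"

lemma regular_on_const: "regular_on K (\<lambda>z. c)"
  by (simp add: regular_on_def)

lemma regular_on_ident: "regular_on K (\<lambda>z. z)"
  by (simp add: regular_on_def)

lemma regular_on_add: "regular_on K f \<Longrightarrow> regular_on K g \<Longrightarrow> regular_on K (\<lambda>z. f z + g z)"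
  by (auto simp: regular_on_def intro: continuous_intros holomorphic_intros)

lemma regular_on_diff: "regular_on K f \<Longrightarrow> regular_on K g \<Longrightarrow> regular_on K (\<lambda>z. f z - g z)"
  by (auto simp: regular_on_def intro: continuous_intros holomorphic_intros)

lemma regular_on_mult: "regular_on K f \<Longrightarrow> regular_on K g \<Longrightarrow> regular_on K (\<lambda>z. f z * g z)"
  by (auto simp: regular_on_def intro: continuous_intros holomorphic_intros)

lemma regular_on_divide:
  assumes "regular_on K f" "regular_on K g" "\<And>z. z \<in> K \<Longrightarrow> g z \<noteq> 0"
  shows "regular_on K (\<lambda>z. f z / g z)"
  using assms interior_subset[of K]
  by (auto simp: regular_on_def intro!: continuous_intros holomorphic_intros)

lemma regular_on_csqrt:
  assumes "regular_on K f" "\<And>z. z \<in> K \<Longrightarrow> f z \<notin> \<real>\<^sub>\<le>\<^sub>0"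
  shows "regular_on K (\<lambda>z. csqrt (f z))"
  using assms interior_subset[of K]
  by (auto simp: regular_on_def intro!: continuous_on_compose2[OF continuous_on_csqrt] holomorphic_on_csqrt')

lemmas regular_on_intros =
  regular_on_const regular_on_ident regular_on_add regular_on_diff regular_on_mult

lemma regular_on_cong:
  "regular_on K f \<Longrightarrow> (\<And>z. z \<in> K \<Longrightarrow> g z = f z) \<Longrightarrow> regular_on K g"
  unfolding regular_on_def
  by (metis (no_types, lifting) continuous_on_cong holomorphic_cong interior_subset subsetD)

lemma regular_on_uniform_limit:
  assumes "uniform_limit K f l sequentially" "\<And>n. regular_on K (f n)"
  shows "regular_on K l"
  unfolding regular_on_def
proof
  show "continuous_on K l"
    by (rule uniform_limit_theorem[OF _ assms(1)]) (use assms(2) in \<open>auto simp: regular_on_def\<close>)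
  show "l holomorphic_on interior K"
  proof (rule holomorphic_uniform_sequence[of _ f])
    fix x assume "x \<in> interior K"
    then obtain d where "d > 0" "cball x d \<subseteq> interior K"
      using open_contains_cball by (meson open_interior)
    then show "\<exists>d>0. cball x d \<subseteq> interior K \<and> uniform_limit (cball x d) f l sequentially"
      using uniform_limit_on_subset[OF assms(1)] interior_subset by (meson order_trans)
  qed (use assms(2) in \<open>auto simp: regular_on_def\<close>)
qed

section \<open>Dominant and recessive solutions of a nearly diagonal system\<close>

lemma uniform_limit_telescope:
  fixes f :: "nat \<Rightarrow> 'a \<Rightarrow> 'b :: banach"
  assumes "summable M" "\<And>n z. z \<in> K \<Longrightarrow> norm (f (Suc n) z - f n z) \<le> M n"
  obtains l where "uniform_limit K f l sequentially"
    "\<And>z. z \<in> K \<Longrightarrow> norm (l z - f 0 z) \<le> suminf M"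
proof -
  let ?S = "\<lambda>z. \<Sum>i. f (Suc i) z - f i z"
  have "uniform_limit K (\<lambda>n z. \<Sum>i<n. f (Suc i) z - f i z) ?S sequentially"
    using assms by (intro Weierstrass_m_test)
  then have "uniform_limit K (\<lambda>n z. f 0 z + (\<Sum>i<n. f (Suc i) z - f i z)) (\<lambda>z. f 0 z + ?S z) sequentially"
    by (intro uniform_limit_intros)
  then have "uniform_limit K f (\<lambda>z. f 0 z + ?S z) sequentially"
    by (simp add: sum_lessThan_telescope[of "\<lambda>i. f i z" for z])
  moreover have "norm (f 0 z + ?S z - f 0 z) \<le> suminf M" if "z \<in> K" for z
    using norm_suminf_le[of "\<lambda>i. f (Suc i) z - f i z" M] assms that by simp
  ultimately show ?thesis using that[of "\<lambda>z. f 0 z + ?S z"] by blast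
qed

text \<open>In coordinates with respect to a slowly varying eigenbasis the system reads
\<open>p' = \<lambda>\<^sup>+ p + \<theta>\<close>, \<open>q' = \<lambda>\<^sup>- q - \<theta>\<close> with \<open>\<theta> = dp \<lambda>\<^sup>+ p + dm \<lambda>\<^sup>- q\<close>. Here \<open>x\<close> and \<open>y\<close> are \<open>p\<close> and \<open>q\<close>
divided by the product of the \<open>\<lambda>\<^sup>+\<close>, and \<open>\<rho> = \<lambda>\<^sup>- / \<lambda>\<^sup>+\<close>. Run forward from \<open>(1, 0)\<close> the solution stays
bounded because \<open>\<bar>\<rho>\<bar> \<le> 1\<close> and the perturbation is summable; this makes the increments of \<open>x\<close>
summable. For \<open>y\<close> one needs more, since \<open>\<rho>\<close> may tend to \<open>1\<close>: the contraction by \<open>1 - c \<delta>\<close> forces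
\<open>\<Sum> \<delta>\<^sub>n \<bar>y\<^sub>n\<bar>\<close> to converge, whether or not \<open>\<Sum> \<delta>\<^sub>n\<close> does, and this sum controls \<open>(1 - \<rho>) y\<close>.\<close>

lemma dominant_solution:
  fixes dp dm \<rho> :: "nat \<Rightarrow> complex \<Rightarrow> complex" and G \<delta> :: "nat \<Rightarrow> real"
  assumes G: "summable G" "\<And>n. 0 \<le> G n" "suminf G \<le> 1/4"
    and d: "\<And>n z. z \<in> K \<Longrightarrow> cmod (dp n z) \<le> G n" "\<And>n z. z \<in> K \<Longrightarrow> cmod (dm n z) \<le> G n"
    and \<rho>: "\<And>n z. z \<in> K \<Longrightarrow> cmod (\<rho> n z) \<le> 1 - c * \<delta> n"
      "\<And>n z. z \<in> K \<Longrightarrow> cmod (1 - \<rho> n z) \<le> C * \<delta> n"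
    and \<delta>: "c > 0" "C \<ge> 0" "\<And>n. 0 \<le> \<delta> n" "\<And>n. c * \<delta> n \<le> 1"
  obtains x y where "\<And>z. x 0 z = 1" "\<And>z. y 0 z = 0"
    "\<And>n z. x (Suc n) z = x n z + (dp n z * x n z + dm n z * (\<rho> n z * y n z))"
    "\<And>n z. y (Suc n) z = \<rho> n z * y n z - (dp n z * x n z + dm n z * (\<rho> n z * y n z))"
    "unif_bv K x" "unif_bv K y" "\<And>n z. z \<in> K \<Longrightarrow> cmod (x n z - 1) \<le> 1/2"
proof -
  define s where "s = rec_nat (\<lambda>z. (1, 0)) (\<lambda>n p z.
     let \<theta> = dp n z * fst (p z) + dm n z * (\<rho> n z * snd (p z))
     in (fst (p z) + \<theta>, \<rho> n z * snd (p z) - \<theta>))"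
  define x where "x n z = fst (s n z)" for n z
  define y where "y n z = snd (s n z)" for n z
  define \<theta> where "\<theta> n z = dp n z * x n z + dm n z * (\<rho> n z * y n z)" for n z
  have rec: "x 0 z = 1" "y 0 z = 0" "x (Suc n) z = x n z + \<theta> n z"
    "y (Suc n) z = \<rho> n z * y n z - \<theta> n z" for n z
    by (simp_all add: x_def y_def \<theta>_def s_def Let_def)
  have \<rho>1: "cmod (\<rho> n z) \<le> 1" if "z \<in> K" for n z
    using \<rho>(1)[OF that, of n] \<delta>(1) \<delta>(3)[of n] by (smt (verit) mult_nonneg_nonneg)
  have \<theta>: "cmod (\<theta> n z) \<le> G n * (cmod (x n z) + cmod (y n z))" if z: "z \<in> K" for n z
  proof -
    have "cmod (\<theta> n z) \<le> cmod (dp n z * x n z) + cmod (dm n z * (\<rho> n z * y n z))"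
      unfolding \<theta>_def by (rule norm_triangle_ineq)
    also have "\<dots> \<le> G n * cmod (x n z) + G n * (1 * cmod (y n z))"
      unfolding norm_mult by (intro add_mono mult_mono d z \<rho>1) (auto simp: G)
    finally show ?thesis by (simp add: algebra_simps)
  qed
  have sumG: "(\<Sum>k<n. G k) \<le> 1/4" for n
    using sum_le_suminf[OF G(1), of "{..<n}"] G(2,3) by auto
  have bd: "cmod (x n z) + cmod (y n z) \<le> 1 + 4 * (\<Sum>k<n. G k)" if z: "z \<in> K" for n z
  proof (induction n)
    case 0
    then show ?case by (simp add: rec)
  next
    case (Suc n)
    have "cmod (x (Suc n) z) \<le> cmod (x n z) + cmod (\<theta> n z)"
      unfolding rec by (rule norm_triangle_ineq)
    moreover have "cmod (y (Suc n) z) \<le> cmod (\<rho> n z * y n z) + cmod (\<theta> n z)"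
      unfolding rec by (rule norm_triangle_ineq4)
    moreover have "cmod (\<rho> n z * y n z) \<le> cmod (y n z)"
      unfolding norm_mult using \<rho>1[OF z] by (intro mult_left_le_one_le) auto
    moreover have "cmod (\<theta> n z) \<le> G n * 2"
      using order_trans[OF \<theta>[OF z] mult_left_mono, of n 2] Suc sumG[of n] G(2)[of n] by auto
    ultimately show ?case using Suc by (simp add: algebra_simps)
  qed
  have bd2: "cmod (x n z) + cmod (y n z) \<le> 2" if z: "z \<in> K" for n z
    using bd[OF z, of n] sumG[of n] by linarith
  have \<theta>2: "cmod (\<theta> n z) \<le> 2 * G n" if z: "z \<in> K" for n z
    using order_trans[OF \<theta>[OF z] mult_left_mono[OF bd2[OF z]], of n] G(2)[of n] by simp
  have x1: "cmod (x n z - 1) \<le> 2 * (\<Sum>k<n. G k)" if z: "z \<in> K" for n z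
  proof (induction n)
    case (Suc n)
    have "x (Suc n) z - 1 = (x n z - 1) + \<theta> n z" by (simp add: rec)
    then have "cmod (x (Suc n) z - 1) \<le> cmod (x n z - 1) + cmod (\<theta> n z)"
      by (metis norm_triangle_ineq)
    then show ?case using Suc \<theta>2[OF z, of n] by simp
  qed (simp add: rec)
  have bvx: "unif_bv K x"
  proof (rule unif_bvI[of "\<lambda>n. 2 * G n" _ _ 2])
    show "summable (\<lambda>n. 2 * G n)" using G by (intro summable_mult)
    show "\<forall>\<^sub>F n in sequentially. \<forall>z\<in>K. cmod (x n z) \<le> 2"
    proof (intro always_eventually allI ballI)
      show "cmod (x n z) \<le> 2" if "z \<in> K" for n z
        using bd2[OF that, of n] norm_ge_zero[of "y n z"] by linarith
    qed
    show "\<forall>\<^sub>F n in sequentially. \<forall>z\<in>K. cmod (x (Suc n) z - x n z) \<le> 2 * G n"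
      using \<theta>2 by (simp add: rec)
  qed
  \<comment> \<open>A majorant of \<open>y\<close> that does not depend on \<open>z\<close>; \<open>\<theta>\<close> enters it through its bound \<open>2 G\<close>.\<close>
  define Y where "Y = rec_nat 0 (\<lambda>n w. (1 - c * \<delta> n) * w + 2 * G n)"
  have Y: "Y 0 = 0" "Y (Suc n) = (1 - c * \<delta> n) * Y n + 2 * G n" for n
    by (simp_all add: Y_def)
  have Y0: "0 \<le> Y n" for n
    by (induction n) (auto simp: Y \<delta> G intro!: add_nonneg_nonneg mult_nonneg_nonneg)
  have yY: "cmod (y n z) \<le> Y n" if z: "z \<in> K" for n z
  proof (induction n)
    case (Suc n)
    have "cmod (y (Suc n) z) \<le> cmod (\<rho> n z * y n z) + cmod (\<theta> n z)"
      unfolding rec by (rule norm_triangle_ineq4)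
    also have "\<dots> \<le> (1 - c * \<delta> n) * Y n + 2 * G n"
      unfolding norm_mult using \<delta>(4)[of n]
      by (intro add_mono mult_mono \<rho> z Suc \<theta>2) auto
    finally show ?case by (simp add: Y)
  qed (simp add: rec Y)
  \<comment> \<open>The loss by the factor \<open>1 - c \<delta>\<close>, summed up, cannot exceed the total input.\<close>
  have tel: "c * (\<Sum>k<n. \<delta> k * Y k) + Y n = 2 * (\<Sum>k<n. G k)" for n
    by (induction n) (auto simp: Y algebra_simps)
  have sY: "summable (\<lambda>k. \<delta> k * Y k)"
  proof (rule bounded_imp_summable[of _ "1 / (2 * c)"])
    show "0 \<le> \<delta> k * Y k" for k using \<delta> Y0 by simp
    show "(\<Sum>k\<le>n. \<delta> k * Y k) \<le> 1 / (2 * c)" for n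
      using tel[of "Suc n"] sumG[of "Suc n"] Y0[of "Suc n"] \<delta>(1)
      by (simp add: lessThan_Suc_atMost field_simps)
  qed
  have bvy: "unif_bv K y"
  proof (rule unif_bvI[of "\<lambda>n. C * (\<delta> n * Y n) + 2 * G n" _ _ 2])
    show "summable (\<lambda>n. C * (\<delta> n * Y n) + 2 * G n)"
      using G sY by (intro summable_mult summable_add)
    show "\<forall>\<^sub>F n in sequentially. \<forall>z\<in>K. cmod (y n z) \<le> 2"
    proof (intro always_eventually allI ballI)
      show "cmod (y n z) \<le> 2" if "z \<in> K" for n z
        using bd2[OF that, of n] norm_ge_zero[of "x n z"] by linarith
    qed
    show "\<forall>\<^sub>F n in sequentially. \<forall>z\<in>K. cmod (y (Suc n) z - y n z) \<le> C * (\<delta> n * Y n) + 2 * G n"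
    proof (intro always_eventually allI ballI)
      fix n z assume z: "z \<in> K"
      have "y (Suc n) z - y n z = - ((1 - \<rho> n z) * y n z + \<theta> n z)"
        by (simp add: rec algebra_simps)
      then have "cmod (y (Suc n) z - y n z) \<le> cmod ((1 - \<rho> n z) * y n z) + cmod (\<theta> n z)"
        by (metis norm_minus_cancel norm_triangle_ineq)
      also have "\<dots> \<le> (C * \<delta> n) * Y n + 2 * G n"
        unfolding norm_mult using \<delta> by (intro add_mono mult_mono \<rho> z yY \<theta>2) auto
      finally show "cmod (y (Suc n) z - y n z) \<le> C * (\<delta> n * Y n) + 2 * G n"
        by (simp add: mult_ac)
    qed
  qed
  show ?thesis
  proof (rule that[of x y])
    show "cmod (x n z - 1) \<le> 1/2" if "z \<in> K" for n z
      using x1[OF that, of n] sumG[of n] by linarith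
  qed (simp_all add: rec bvx bvy \<theta>_def)
qed

text \<open>The same system normalised by the product of the \<open>\<lambda>\<^sup>-\<close> and solved for the earlier vector. Forward
in time it expands its first coordinate, but backward in time it is a contraction up to a summable
perturbation. Starting from \<open>(0, 1)\<close> at a late index and going back, the result changes only by
the perturbation at that index when the start is moved one step further; hence there is a limit,
uniform in \<open>z\<close>, and it is close to \<open>(0, 1)\<close> at late indices. The coefficients \<open>fp\<close> and \<open>fm\<close> express the
perturbation in terms of the later vector.\<close>

lemma recessive_solution:
  fixes fp fm \<rho> :: "nat \<Rightarrow> complex \<Rightarrow> complex" and G :: "nat \<Rightarrow> real"
  assumes G: "summable G" "\<And>n. 0 \<le> G n" "suminf G \<le> 1/4"
    and f: "\<And>n z. z \<in> K \<Longrightarrow> cmod (fp n z) \<le> G n" "\<And>n z. z \<in> K \<Longrightarrow> cmod (fm n z) \<le> G n"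
    and \<rho>: "\<And>n z. z \<in> K \<Longrightarrow> cmod (\<rho> n z) \<le> 1"
    and reg: "\<And>n. regular_on K (fp n)" "\<And>n. regular_on K (fm n)" "\<And>n. regular_on K (\<rho> n)"
  obtains x y where
    "\<And>n z. z \<in> K \<Longrightarrow>
       x n z = \<rho> n z * (x (Suc n) z - (fp n z * x (Suc n) z + fm n z * y (Suc n) z))"
    "\<And>n z. z \<in> K \<Longrightarrow> y n z = y (Suc n) z + (fp n z * x (Suc n) z + fm n z * y (Suc n) z)"
    "\<And>n. regular_on K (x n)" "\<And>n. regular_on K (y n)"
    "uniform_limit K x (\<lambda>z. 0) sequentially" "uniform_limit K y (\<lambda>z. 1) sequentially"
proof -
  \<comment> \<open>\<open>V l n\<close> is the vector at index \<open>n\<close> of the solution that equals \<open>(0, 1)\<close> at index \<open>n + l\<close>.\<close>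
  define V where "V = rec_nat (\<lambda>n z. (0, 1)) (\<lambda>l p n z.
     let x = fst (p (Suc n) z); y = snd (p (Suc n) z); \<theta> = fp n z * x + fm n z * y
     in (\<rho> n z * (x - \<theta>), y + \<theta>))"
  define u where "u l n z = fst (V l n z)" for l n z
  define v where "v l n z = snd (V l n z)" for l n z
  have rec: "u 0 n z = 0" "v 0 n z = 1"
    "u (Suc l) n z = \<rho> n z * (u l (Suc n) z - (fp n z * u l (Suc n) z + fm n z * v l (Suc n) z))"
    "v (Suc l) n z = v l (Suc n) z + (fp n z * u l (Suc n) z + fm n z * v l (Suc n) z)" for l n z
    by (simp_all add: u_def v_def V_def Let_def)
  have step: "cmod (\<rho> n z * (s - (fp n z * s + fm n z * t))) + cmod (t + (fp n z * s + fm n z * t))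
      \<le> (1 + 2 * G n) * (cmod s + cmod t)" if z: "z \<in> K" for n z s t
  proof -
    let ?\<theta> = "fp n z * s + fm n z * t"
    have "cmod ?\<theta> \<le> cmod (fp n z * s) + cmod (fm n z * t)" by (rule norm_triangle_ineq)
    also have "\<dots> \<le> G n * cmod s + G n * cmod t"
      unfolding norm_mult by (intro add_mono mult_right_mono f z) auto
    finally have \<theta>: "cmod ?\<theta> \<le> G n * cmod s + G n * cmod t" .
    have "cmod (\<rho> n z * (s - ?\<theta>)) \<le> cmod (s - ?\<theta>)"
      unfolding norm_mult using \<rho>[OF z] by (intro mult_left_le_one_le) auto
    also have "\<dots> \<le> cmod s + cmod ?\<theta>" by (rule norm_triangle_ineq4)
    finally have "cmod (\<rho> n z * (s - ?\<theta>)) \<le> cmod s + cmod ?\<theta>" .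
    moreover have "cmod (t + ?\<theta>) \<le> cmod t + cmod ?\<theta>" by (rule norm_triangle_ineq)
    ultimately show ?thesis using \<theta> by (simp add: algebra_simps)
  qed
  \<comment> \<open>The effect at index \<open>n\<close> of moving the start from \<open>n + l\<close> to \<open>n + l + 1\<close>.\<close>
  define D where "D l n z = cmod (u (Suc l) n z - u l n z) + cmod (v (Suc l) n z - v l n z)" for l n z
  have sumG: "(\<Sum>k\<in>{n..<m}. G k) \<le> 1/4" for n m
    using sum_le_suminf[OF G(1), of "{n..<m}"] G(2,3) by auto
  have D: "D l n z \<le> (1 + 4 * (\<Sum>k\<in>{n..<n+l}. G k)) * (2 * G (n + l))" if z: "z \<in> K" for l n z
  proof (induction l arbitrary: n)
    case 0
    have "D 0 n z = cmod (\<rho> n z) * cmod (fm n z) + cmod (fm n z)"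
      by (simp add: D_def rec norm_mult)
    also have "\<dots> \<le> 1 * G n + G n"
      by (intro add_mono mult_mono \<rho> f z) auto
    finally show ?case by simp
  next
    case (Suc l)
    let ?S = "\<Sum>k\<in>{Suc n..<Suc n+l}. G k"
    have "D (Suc l) n z \<le> (1 + 2 * G n) * D l (Suc n) z"
      using step[OF z, of n "u (Suc l) (Suc n) z - u l (Suc n) z" "v (Suc l) (Suc n) z - v l (Suc n) z"]
      unfolding D_def rec(3)[of "Suc l"] rec(4)[of "Suc l"] rec(3)[of l n] rec(4)[of l n]
      by (simp add: algebra_simps)
    also have "\<dots> \<le> (1 + 2 * G n) * ((1 + 4 * ?S) * (2 * G (Suc n + l)))"
      using Suc[of "Suc n"] G(2)[of n] by (intro mult_left_mono) auto
    also have "\<dots> = ((1 + 2 * G n) * (1 + 4 * ?S)) * (2 * G (Suc n + l))" by simp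
    also have "\<dots> \<le> (1 + 4 * (G n + ?S)) * (2 * G (Suc n + l))"
    proof (rule mult_right_mono)
      have "G n * ?S \<le> G n * (1/4)" using G(2) sumG by (intro mult_left_mono)
      then show "(1 + 2 * G n) * (1 + 4 * ?S) \<le> 1 + 4 * (G n + ?S)" by (simp add: algebra_simps)
    qed (use G in auto)
    also have "G n + ?S = (\<Sum>k\<in>{n..<n+Suc l}. G k)"
      by (subst sum.atLeast_Suc_lessThan[of n]) auto
    finally show ?case by simp
  qed
  have D4: "D l n z \<le> 4 * G (l + n)" if z: "z \<in> K" for l n z
  proof -
    have "(1 + 4 * (\<Sum>k\<in>{n..<n+l}. G k)) * (2 * G (n + l)) \<le> 2 * (2 * G (n + l))"
      using sumG[of n "n+l"] G(2) by (intro mult_right_mono) auto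
    from order_trans[OF D[OF z, of l n] this] show ?thesis by (simp add: add.commute)
  qed
  have s4: "summable (\<lambda>l. 4 * G (l + n))" for n
    using G(1) by (intro summable_mult) (simp add: summable_iff_shift)
  have exx: "\<exists>l. uniform_limit K (\<lambda>l. u l n) l sequentially \<and>
      (\<forall>z\<in>K. cmod (l z - u 0 n z) \<le> (\<Sum>l. 4 * G (l + n)))" for n
  proof (rule uniform_limit_telescope[OF s4[of n], of K "\<lambda>l. u l n"])
    show "cmod (u (Suc l) n z - u l n z) \<le> 4 * G (l + n)" if "z \<in> K" for l z
      using D4[OF that, of l n] norm_ge_zero[of "v (Suc l) n z - v l n z"] unfolding D_def by linarith
  qed blast
  have exy: "\<exists>l. uniform_limit K (\<lambda>l. v l n) l sequentially \<and>
      (\<forall>z\<in>K. cmod (l z - v 0 n z) \<le> (\<Sum>l. 4 * G (l + n)))" for n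
  proof (rule uniform_limit_telescope[OF s4[of n], of K "\<lambda>l. v l n"])
    show "cmod (v (Suc l) n z - v l n z) \<le> 4 * G (l + n)" if "z \<in> K" for l z
      using D4[OF that, of l n] norm_ge_zero[of "u (Suc l) n z - u l n z"] unfolding D_def by linarith
  qed blast
  obtain x where x: "\<And>n. uniform_limit K (\<lambda>l. u l n) (x n) sequentially"
    "\<And>n z. z \<in> K \<Longrightarrow> cmod (x n z) \<le> (\<Sum>l. 4 * G (l + n))"
    using exx unfolding rec by (metis diff_zero)
  obtain y where y: "\<And>n. uniform_limit K (\<lambda>l. v l n) (y n) sequentially"
    "\<And>n z. z \<in> K \<Longrightarrow> cmod (y n z - 1) \<le> (\<Sum>l. 4 * G (l + n))"
    using exy unfolding rec by metis
  have limx: "(\<lambda>l. u l n z) \<longlonglongrightarrow> x n z" and limy: "(\<lambda>l. v l n z) \<longlonglongrightarrow> y n z" if "z \<in> K" for n z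
    using tendsto_uniform_limitI[OF x(1) that] tendsto_uniform_limitI[OF y(1) that] by auto
  have reguv: "regular_on K (u l n) \<and> regular_on K (v l n)" for l n
  proof (induction l arbitrary: n)
    case 0
    have "u 0 n = (\<lambda>z. 0)" "v 0 n = (\<lambda>z. 1)" by (auto simp: rec)
    then show ?case by (simp add: regular_on_const)
  next
    case (Suc l)
    have "u (Suc l) n = (\<lambda>z. \<rho> n z * (u l (Suc n) z - (fp n z * u l (Suc n) z + fm n z * v l (Suc n) z)))"
      "v (Suc l) n = (\<lambda>z. v l (Suc n) z + (fp n z * u l (Suc n) z + fm n z * v l (Suc n) z))"
      by (auto simp: rec)
    then show ?case using Suc by (auto intro!: regular_on_intros reg)
  qed
  have tail: "(\<lambda>n. \<Sum>l. 4 * G (l + n)) \<longlonglongrightarrow> 0"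
    by (rule suminf_exist_split2) (intro summable_mult G(1))
  have tailU: "uniform_limit K h h0 sequentially"
    if "\<And>n z. z \<in> K \<Longrightarrow> cmod (h n z - h0 z) \<le> (\<Sum>l. 4 * G (l + n))" for h h0
  proof (rule uniform_limitI)
    fix e :: real assume "e > 0"
    then have "\<forall>\<^sub>F n in sequentially. (\<Sum>l. 4 * G (l + n)) < e"
      using order_tendstoD(2)[OF tail] by simp
    then show "\<forall>\<^sub>F n in sequentially. \<forall>z\<in>K. dist (h n z) (h0 z) < e"
      by eventually_elim (use that in \<open>auto simp: dist_norm intro: le_less_trans\<close>)
  qed
  show ?thesis
  proof (rule that[of x y])
    fix n z assume z: "z \<in> K"
    have "(\<lambda>l. u (Suc l) n z) \<longlonglongrightarrow>
        \<rho> n z * (x (Suc n) z - (fp n z * x (Suc n) z + fm n z * y (Suc n) z))"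
      unfolding rec by (intro tendsto_intros limx limy z)
    then show "x n z = \<rho> n z * (x (Suc n) z - (fp n z * x (Suc n) z + fm n z * y (Suc n) z))"
      using LIMSEQ_unique LIMSEQ_Suc[OF limx[OF z]] by blast
    have "(\<lambda>l. v (Suc l) n z) \<longlonglongrightarrow> y (Suc n) z + (fp n z * x (Suc n) z + fm n z * y (Suc n) z)"
      unfolding rec by (intro tendsto_intros limx limy z)
    then show "y n z = y (Suc n) z + (fp n z * x (Suc n) z + fm n z * y (Suc n) z)"
      using LIMSEQ_unique LIMSEQ_Suc[OF limy[OF z]] by blast
  next
    show "regular_on K (x n)" "regular_on K (y n)" for n
      using reguv by (blast intro: regular_on_uniform_limit[OF x(1)] regular_on_uniform_limit[OF y(1)])+
    show "uniform_limit K x (\<lambda>z. 0) sequentially" "uniform_limit K y (\<lambda>z. 1) sequentially"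
      using x(2) y(2) by (auto intro!: tailU)
  qed
qed

section \<open>Branches and moduli of the eigenvalues\<close>

text \<open>With \<open>p + \<i> q\<close> and \<open>r + \<i> s\<close> the roots of \<open>w - 1\<close> and \<open>w + 1\<close> one has \<open>p q = r s\<close>, and if \<open>r > 0\<close>,
eliminating \<open>s\<close> shows that both real parts are \<open>r\<^sup>2 - q\<^sup>2\<close> times a nonnegative factor. The product of the roots is
a square root of \<open>w\<^sup>2 - 1\<close>, so this decides which of the two roots it is: the principal one in the
right half-plane and its negative in the left one.\<close>

lemma Re_csqrt_mult_sign: "0 \<le> Re w * Re (csqrt (w - 1) * csqrt (w + 1))"
proof -
  define p q r s where "p = Re (csqrt (w - 1))" "q = Im (csqrt (w - 1))"
    "r = Re (csqrt (w + 1))" "s = Im (csqrt (w + 1))"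
  have pr: "0 \<le> p" "0 \<le> r" "p = 0 \<Longrightarrow> 0 \<le> q" "r = 0 \<Longrightarrow> 0 \<le> s"
    using csqrt_principal[of "w - 1"] csqrt_principal[of "w + 1"]
    unfolding p_q_r_s_def by auto
  have "p\<^sup>2 - q\<^sup>2 = Re w - 1" "2 * p * q = Im w"
    using arg_cong[OF power2_csqrt[of "w - 1"], of Re] arg_cong[OF power2_csqrt[of "w - 1"], of Im]
    unfolding p_q_r_s_def Re_power2 Im_power2 by simp_all
  moreover have "r\<^sup>2 - s\<^sup>2 = Re w + 1" "2 * r * s = Im w"
    using arg_cong[OF power2_csqrt[of "w + 1"], of Re] arg_cong[OF power2_csqrt[of "w + 1"], of Im]
    unfolding p_q_r_s_def Re_power2 Im_power2 by simp_all
  ultimately have sq: "p * p - q * q = Re w - 1" "r * r - s * s = Re w + 1" "p * q = r * s"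
    unfolding power2_eq_square by linarith+
  have Reg: "Re (csqrt (w - 1) * csqrt (w + 1)) = p * r - q * s"
    by (simp add: p_q_r_s_def)
  show ?thesis
  proof (cases "r = 0")
    case True
    have "Re w < 0" using sq(2) zero_le_square[of s] unfolding True by linarith
    then have "p * p - q * q < 0" using sq(1) by simp
    then have "q * q \<noteq> 0" using zero_le_square[of p] by linarith
    then have "q \<noteq> 0" by simp
    then have "p = 0" using sq(3) True by simp
    then have "p * r - q * s \<le> 0" using pr True by simp
    then show ?thesis unfolding Reg using \<open>Re w < 0\<close> by (simp add: mult_nonpos_nonpos)
  next
    case False
    then have r: "r > 0" using pr by simp
    then have s: "s = p * q / r" using sq(3) by (simp add: field_simps)
    have "r * r - q * q + (p * p - s * s) = 2 * Re w" using sq by simp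
    then have 1: "Re w = (r * r - q * q) * ((1 + (p / r) * (p / r)) / 2)"
      unfolding s using r by (simp add: field_simps)
    have 2: "p * r - q * s = (r * r - q * q) * (p / r)"
      unfolding s using r by (simp add: field_simps)
    have 3: "(t * k1) * (t * k2) = (t * t) * (k1 * k2)" for t k1 k2 :: real
      by simp
    show ?thesis unfolding Reg 1 2 3
      using pr r by (intro mult_nonneg_nonneg[OF zero_le_square mult_nonneg_nonneg]) auto
  qed
qed

text \<open>The two eigenvalues of \<open>\<epsilon> + R / A\<close>, where \<open>R\<close> has trace \<open>\<tau>\<close> and discriminant \<open>S\<^sup>2\<close>. The difference of
their squared moduli is \<open>2 / A\<close> times \<open>Re ((1 + \<epsilon> \<eta>) cnj S)\<close> with \<open>\<eta> = \<tau> / (2 A)\<close> small, and this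
is at least \<open>c / A\<close> because \<open>Re S \<ge> c\<close>. So the ratio stays below \<open>1\<close> by an amount of the same
order as its distance from \<open>1\<close>.\<close>

lemma eigenvalue_ratio_bounds:
  fixes \<epsilon> A c :: real and S \<tau> :: complex
  assumes \<epsilon>: "\<epsilon> \<in> {-1, 1}" and A: "A > 0" and c: "c > 0" "c \<le> Re S"
    and b: "cmod S \<le> C" "cmod \<tau> \<le> C'" "C' \<le> A / 2" "C \<le> A / 2" "C * C' \<le> c * A"
    and lp: "lp = of_real \<epsilon> + \<tau> / of_real (2 * A) + of_real \<epsilon> * S / of_real (2 * A)"
    and lm: "lm = of_real \<epsilon> + \<tau> / of_real (2 * A) - of_real \<epsilon> * S / of_real (2 * A)"
  shows "lp \<noteq> 0" "lm \<noteq> 0" "cmod (lm / lp) \<le> 1 - c / 8 * (1 / A)"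
    "cmod (1 - lm / lp) \<le> 2 * C * (1 / A)" "c / 8 * (1 / A) \<le> 1"
proof -
  define D where "D = of_real \<epsilon> * S / of_real (2 * A)"
  define \<eta> where "\<eta> = \<tau> / of_real (2 * A)"
  have ab: "\<bar>\<epsilon>\<bar> = 1" "\<epsilon> * \<epsilon> = 1" using \<epsilon> by auto
  have cC: "c \<le> C" using c b complex_Re_le_cmod[of S] by linarith
  have \<eta>: "cmod \<eta> \<le> C' / (2 * A)" "cmod \<eta> \<le> 1/4"
    using b A by (auto simp: \<eta>_def norm_divide norm_mult field_simps intro: order_trans)
  have D: "cmod D \<le> C / (2 * A)" "cmod D \<le> 1/4"
    using b A ab by (auto simp: D_def norm_divide norm_mult field_simps intro: order_trans)
  have lpD: "lp = of_real \<epsilon> + (\<eta> + D)" and lmD: "lm = of_real \<epsilon> + (\<eta> - D)"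
    by (simp_all add: lp lm D_def \<eta>_def)
  have e1: "cmod (of_real \<epsilon>) = 1" using ab by simp
  have s1: "cmod (\<eta> + D) \<le> 1/2" "cmod (\<eta> - D) \<le> 1/2"
    using norm_triangle_ineq[of \<eta> D] norm_triangle_ineq4[of \<eta> D] \<eta> D by linarith+
  have lp2: "1/2 \<le> cmod lp" "cmod lp \<le> 2" and lm2: "1/2 \<le> cmod lm"
    using norm_diff_ineq[of "of_real \<epsilon> :: complex" "\<eta> + D"]
      norm_diff_ineq[of "of_real \<epsilon> :: complex" "\<eta> - D"]
      norm_triangle_ineq[of "of_real \<epsilon> :: complex" "\<eta> + D"] s1 e1
    unfolding lpD lmD by linarith+
  show ne: "lp \<noteq> 0" "lm \<noteq> 0" using lp2 lm2 by auto
  show c8: "c / 8 * (1 / A) \<le> 1" using cC b A by (simp add: field_simps)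
  have dS: "lp - lm = of_real \<epsilon> * S / of_real A"
    using A by (simp add: lpD lmD D_def field_simps)
  have "1 - lm / lp = of_real \<epsilon> * S / of_real A / lp"
    using ne(1) by (simp add: dS[symmetric] diff_divide_distrib)
  then have "cmod (1 - lm / lp) = cmod S / A / cmod lp"
    using A ab(1) by (simp add: norm_divide norm_mult)
  also have "\<dots> \<le> C / A / (1/2)"
    using b A lp2 cC c by (intro frac_le divide_right_mono) auto
  finally show "cmod (1 - lm / lp) \<le> 2 * C * (1 / A)" by (simp add: field_simps)
  have "(cmod lp)\<^sup>2 - (cmod lm)\<^sup>2 = 4 * Re ((of_real \<epsilon> + \<eta>) * cnj D)"
    unfolding lpD lmD cmod_power2 by (simp add: power2_eq_square algebra_simps)
  also have "\<dots> = (2 / A) * Re ((1 + of_real \<epsilon> * \<eta>) * cnj S)"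
    using A ab(2) by (simp add: D_def field_simps)
  also have "\<dots> \<ge> (2 / A) * (c / 2)"
  proof (intro mult_left_mono)
    have "cmod (of_real \<epsilon> * \<eta> * cnj S) \<le> C' / (2 * A) * C"
      unfolding norm_mult complex_mod_cnj e1 mult_1 using \<eta> b A by (intro mult_mono) (auto intro: order_trans[OF norm_ge_zero])
    also have "\<dots> \<le> c / 2" using b(5) A by (simp add: field_simps)
    finally have "- (c / 2) \<le> Re (of_real \<epsilon> * \<eta> * cnj S)"
      using abs_Re_le_cmod[of "of_real \<epsilon> * \<eta> * cnj S"] by linarith
    moreover have "Re ((1 + of_real \<epsilon> * \<eta>) * cnj S) = Re S + Re (of_real \<epsilon> * \<eta> * cnj S)"
      by (simp add: algebra_simps)
    ultimately show "c / 2 \<le> Re ((1 + of_real \<epsilon> * \<eta>) * cnj S)" using c(2) by linarith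
  qed (use A in auto)
  finally have diff: "(cmod lm)\<^sup>2 \<le> (cmod lp)\<^sup>2 - c / A" by simp
  have "(cmod (lm / lp))\<^sup>2 = (cmod lm)\<^sup>2 / (cmod lp)\<^sup>2"
    by (simp add: norm_divide power_divide)
  also have "\<dots> \<le> ((cmod lp)\<^sup>2 - c / A) / (cmod lp)\<^sup>2"
    using diff by (intro divide_right_mono) auto
  also have "\<dots> = 1 - c / A / (cmod lp)\<^sup>2"
    using ne by (simp add: diff_divide_distrib)
  also have "\<dots> \<le> 1 - c / A / 2\<^sup>2"
    using c A lp2 ne by (intro diff_left_mono divide_left_mono power_mono) auto
  also have "\<dots> \<le> (1 - c / 8 * (1 / A))\<^sup>2"
    by (simp add: power2_eq_square algebra_simps)
  finally show "cmod (lm / lp) \<le> 1 - c / 8 * (1 / A)"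
    by (rule power2_le_imp_le) (use c8 in simp)
qed

section \<open>A discrete Levinson theorem\<close>

text \<open>One step of the system in the eigenvectors \<open>(1, mp)\<close> and \<open>(1, mm)\<close>, followed by the change to the
next eigenbasis \<open>(1, mp')\<close>, \<open>(1, mm')\<close>. As the first entries are all \<open>1\<close>, the change of basis has
rank one: it moves an amount \<open>\<theta>\<close> from the second coordinate to the first.\<close>

lemma eigenbasis_step:
  fixes y11 y12 y21 y22 lp lm mp mm mp' mm' p q p' q' \<theta> :: complex
  assumes "lp = y11 + y12 * mp" "lp * mp = y21 + y22 * mp"
    and "lm = y11 + y12 * mm" "lm * mm = y21 + y22 * mm"
    and "mm' \<noteq> mp'"
    and \<theta>: "\<theta> = (mp' - mp) / (mm' - mp') * (lp * p) + (mm' - mm) / (mm' - mp') * (lm * q)"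
    and "p' = lp * p + \<theta>" "q' = lm * q - \<theta>"
  shows "p' + q' = y11 * (p + q) + y12 * (mp * p + mm * q)"
    "mp' * p' + mm' * q' = y21 * (p + q) + y22 * (mp * p + mm * q)"
proof -
  have "(mm' - mp') * \<theta> = (mp' - mp) * (lp * p) + (mm' - mm) * (lm * q)"
    using assms(5) unfolding \<theta> distrib_left by simp
  moreover have "mp' * p' + mm' * q' = mp' * (lp * p) + mm' * (lm * q) - (mm' - mp') * \<theta>"
    by (simp add: assms(7,8) algebra_simps)
  ultimately have "mp' * p' + mm' * q'
      = mp' * (lp * p) + mm' * (lm * q) - ((mp' - mp) * (lp * p) + (mm' - mm) * (lm * q))"
    by simp
  also have "\<dots> = (lp * mp) * p + (lm * mm) * q"
    by (simp add: algebra_simps)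
  also have "\<dots> = y21 * (p + q) + y22 * (mp * p + mm * q)"
    unfolding assms(2,4) by (simp add: algebra_simps)
  finally show "mp' * p' + mm' * q' = y21 * (p + q) + y22 * (mp * p + mm * q)" .
  have "p' + q' = lp * p + lm * q" by (simp add: assms(7,8))
  then show "p' + q' = y11 * (p + q) + y12 * (mp * p + mm * q)"
    unfolding assms(1,3) by (simp add: algebra_simps)
qed

text \<open>The eigenvector for the eigenvalue \<open>l\<close> is \<open>(1, m)\<close>. Applied with \<open>S\<close> and with \<open>- S\<close> this covers
both eigenvalues.\<close>

lemma eigenvector_slope:
  fixes e A r11 r12 r21 r22 S l :: complex
  assumes "S\<^sup>2 = (r11 - r22)\<^sup>2 + 4 * r12 * r21" "e\<^sup>2 = 1" "r12 \<noteq> 0" "A \<noteq> 0"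
    and l: "l = e + (r11 + r22) / (2 * A) + e * S / (2 * A)"
    and m: "m = (r22 - r11 + e * S) / (2 * r12)"
  shows "l = (e + r11 / A) + r12 / A * m" "l * m = r21 / A + (e + r22 / A) * m"
proof -
  show "l = (e + r11 / A) + r12 / A * m"
    using assms(3,4) by (simp add: l m field_simps)
  have "(e * S)\<^sup>2 = (r11 - r22)\<^sup>2 + 4 * r12 * r21" using assms(1,2) by (simp add: power_mult_distrib)
  moreover have "(r11 - r22 + e * S) * (r22 - r11 + e * S) = (e * S)\<^sup>2 - (r11 - r22)\<^sup>2"
    by (simp add: power2_eq_square algebra_simps)
  ultimately have "(r11 - r22 + e * S) * (r22 - r11 + e * S) = 4 * r12 * r21"
    by simp
  moreover have "l - (e + r22 / A) = (r11 - r22 + e * S) / (2 * A)"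
    using assms(4) by (simp add: l field_simps)
  ultimately have "(l - (e + r22 / A)) * m = 4 * r12 * r21 / (2 * A * (2 * r12))"
    by (simp add: m)
  also have "\<dots> = r21 / A"
    using assms(3) by simp
  finally have "(l - (e + r22 / A)) * m = r21 / A" .
  then show "l * m = r21 / A + (e + r22 / A) * m" by (simp add: algebra_simps)
qed

lemma uniform_limit_minus_nat:
  assumes "uniform_limit K f l sequentially"
  shows "uniform_limit K (\<lambda>n. f (n - M)) l sequentially"
  using filterlim_compose[OF assms filterlim_minus_const_nat_at_top[of M]] by simp

lemma bounded_image_mult:
  fixes f g :: "'a \<Rightarrow> 'b :: real_normed_algebra"
  assumes "bounded (f ` K)" "bounded (g ` K)"
  shows "bounded ((\<lambda>z. f z * g z) ` K)"
proof -
  obtain B C where "\<And>z. z \<in> K \<Longrightarrow> norm (f z) \<le> B" "\<And>z. z \<in> K \<Longrightarrow> norm (g z) \<le> C"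
    using assms unfolding bounded_iff by (metis imageI)
  then have "norm (f z * g z) \<le> B * C" if "z \<in> K" for z
    using that by (meson mult_mono norm_ge_zero norm_mult_ineq order_trans)
  then show ?thesis unfolding bounded_iff by blast
qed

text \<open>The system with matrices \<open>\<epsilon> + R\<^sub>n / A\<^sub>n\<close>. The lower bound for \<open>r12\<close> makes the slopes of the
eigenvectors regular and of bounded variation, the lower bound for the root of the discriminant
keeps them apart; together they make the change of eigenbasis in each step summable. The solutions
\<open>p\<close> and \<open>q\<close> come from the dominant and the recessive solution; their normalised limits are
independent because the dominant one has a nonzero component along the first eigenvector while
the recessive one is asymptotic to the second.\<close>

theorem discrete_Levinson:
  fixes A :: "nat \<Rightarrow> real" and \<epsilon> c :: real
    and r11 r12 r21 r22 lp lm :: "nat \<Rightarrow> complex \<Rightarrow> complex"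
  defines "H \<equiv> \<lambda>n z. (r11 n z - r22 n z)\<^sup>2 + 4 * r12 n z * r21 n z"
  assumes \<epsilon>: "\<epsilon> \<in> {-1, 1}"
    and A: "\<And>n. A n > 0" "filterlim A at_top sequentially"
    and bv: "unif_bv K r11" "unif_bv K r12" "unif_bv K r21" "unif_bv K r22"
    and reg: "\<And>n. regular_on K (r11 n)" "\<And>n. regular_on K (r12 n)"
      "\<And>n. regular_on K (r21 n)" "\<And>n. regular_on K (r22 n)"
    and c: "c > 0" "\<forall>\<^sub>F n in sequentially. \<forall>z\<in>K. c \<le> cmod (r12 n z)"
      "\<forall>\<^sub>F n in sequentially. \<forall>z\<in>K. c \<le> Re (csqrt (H n z))"
    and ev: "\<forall>\<^sub>F n in sequentially. \<forall>z\<in>K. lp n z = of_real \<epsilon>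
          + (r11 n z + r22 n z) / of_real (2 * A n) + of_real \<epsilon> * csqrt (H n z) / of_real (2 * A n)"
      "\<forall>\<^sub>F n in sequentially. \<forall>z\<in>K. lm n z = of_real \<epsilon>
          + (r11 n z + r22 n z) / of_real (2 * A n) - of_real \<epsilon> * csqrt (H n z) / of_real (2 * A n)"
  shows "\<exists>M\<ge>1. \<exists>p1 p2 q1 q2 f1 f2 g1 g2.
     (\<forall>n\<ge>M. \<forall>z\<in>K. lp n z \<noteq> 0 \<and> lm n z \<noteq> 0 \<and>
        p1 (Suc n) z = (of_real \<epsilon> + r11 n z / of_real (A n)) * p1 n z + r12 n z / of_real (A n) * p2 n z \<and>
        p2 (Suc n) z = r21 n z / of_real (A n) * p1 n z + (of_real \<epsilon> + r22 n z / of_real (A n)) * p2 n z \<and>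
        q1 (Suc n) z = (of_real \<epsilon> + r11 n z / of_real (A n)) * q1 n z + r12 n z / of_real (A n) * q2 n z \<and>
        q2 (Suc n) z = r21 n z / of_real (A n) * q1 n z + (of_real \<epsilon> + r22 n z / of_real (A n)) * q2 n z) \<and>
     regular_on K (p1 M) \<and> regular_on K (p2 M) \<and> regular_on K (q1 M) \<and> regular_on K (q2 M) \<and>
     uniform_limit K (\<lambda>n z. p1 n z / (\<Prod>j\<in>{M..<n}. lp j z)) f1 sequentially \<and>
     uniform_limit K (\<lambda>n z. p2 n z / (\<Prod>j\<in>{M..<n}. lp j z)) f2 sequentially \<and>
     uniform_limit K (\<lambda>n z. q1 n z / (\<Prod>j\<in>{M..<n}. lm j z)) g1 sequentially \<and>
     uniform_limit K (\<lambda>n z. q2 n z / (\<Prod>j\<in>{M..<n}. lm j z)) g2 sequentially \<and>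
     bounded (f1 ` K) \<and> bounded (f2 ` K) \<and> bounded (g1 ` K) \<and> bounded (g2 ` K) \<and>
     (\<forall>z\<in>K. f1 z * g2 z \<noteq> f2 z * g1 z)"
proof -
  define e :: complex where "e = of_real \<epsilon>"
  have e: "e\<^sup>2 = 1" "cmod e = 1" "e \<noteq> 0" using \<epsilon> by (auto simp: e_def)
  define S where "S n z = csqrt (H n z)" for n z
  have S2: "(S n z)\<^sup>2 = (r11 n z - r22 n z)\<^sup>2 + 4 * r12 n z * r21 n z" for n z
    by (simp add: S_def H_def)
  have bvH: "unif_bv K H"
    unfolding H_def power2_eq_square mult.assoc by (intro unif_bv_add unif_bv_mult unif_bv_diff unif_bv_cmult bv)
  have bvS: "unif_bv K S"
    unfolding S_def using bvH c(1,3) by (rule unif_bv_csqrt)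
  define mp where "mp n z = (r22 n z - r11 n z + e * S n z) / (2 * r12 n z)" for n z
  define mm where "mm n z = (r22 n z - r11 n z - e * S n z) / (2 * r12 n z)" for n z
  have mp_alt: "mp = (\<lambda>n z. (1/2) * ((r22 n z - r11 n z + e * S n z) * inverse (r12 n z)))"
    and mm_alt: "mm = (\<lambda>n z. (1/2) * ((r22 n z - r11 n z - e * S n z) * inverse (r12 n z)))"
    by (auto simp: fun_eq_iff mp_def mm_def field_simps)
  have bvi: "unif_bv K (\<lambda>n z. inverse (r12 n z))"
    using bv(2) c(1,2) by (rule unif_bv_inverse)
  have bvm: "unif_bv K mp" "unif_bv K mm"
    unfolding mp_alt mm_alt by (intro unif_bv_cmult unif_bv_mult unif_bv_add unif_bv_diff bv bvi bvS)+
  obtain C12 where C12: "C12 > 0" "\<forall>\<^sub>F n in sequentially. \<forall>z\<in>K. cmod (r12 n z) \<le> C12"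
    by (rule unif_bvE[OF bv(2)], rule that)
  obtain CS where CS: "CS > 0" "\<forall>\<^sub>F n in sequentially. \<forall>z\<in>K. cmod (S n z) \<le> CS"
    by (rule unif_bvE[OF bvS], rule that)
  obtain Ct where Ct: "Ct > 0" "\<forall>\<^sub>F n in sequentially. \<forall>z\<in>K. cmod (r11 n z + r22 n z) \<le> Ct"
    by (rule unif_bvE[OF unif_bv_add[OF bv(1,4)]], rule that)
  define b where "b = c / C12"
  have b: "b > 0" using c C12 by (simp add: b_def)
  have gap: "\<forall>\<^sub>F n in sequentially. \<forall>z\<in>K. b \<le> cmod (mm n z - mp n z)"
    using c(2,3) C12(2)
  proof eventually_elim
    case (elim n)
    show ?case
    proof
      fix z assume z: "z \<in> K"
      have ne: "r12 n z \<noteq> 0" using elim z c(1) by force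
      have "mm n z - mp n z = - (e * S n z / r12 n z)"
        using ne by (simp add: mm_def mp_def field_simps)
      then have "cmod (mm n z - mp n z) = cmod (S n z) / cmod (r12 n z)"
        by (simp add: norm_divide norm_mult e)
      moreover have "c \<le> cmod (S n z)"
        using order_trans[OF elim(2)[rule_format, OF z] complex_Re_le_cmod] unfolding S_def .
      ultimately show "b \<le> cmod (mm n z - mp n z)"
        unfolding b_def using elim(3)[rule_format, OF z] ne c(1) by (simp add: frac_le)
    qed
  qed
  obtain G1 where G1: "summable G1" "\<And>n. 0 \<le> G1 n"
    "\<forall>\<^sub>F n in sequentially. \<forall>z\<in>K. cmod (mp (Suc n) z - mp n z) \<le> G1 n"
    by (rule unif_bvE[OF bvm(1)], rule that)
  obtain G2 where G2: "summable G2" "\<And>n. 0 \<le> G2 n"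
    "\<forall>\<^sub>F n in sequentially. \<forall>z\<in>K. cmod (mm (Suc n) z - mm n z) \<le> G2 n"
    by (rule unif_bvE[OF bvm(2)], rule that)
  define dp where "dp n z = (mp (Suc n) z - mp n z) / (mm (Suc n) z - mp (Suc n) z)" for n z
  define dm where "dm n z = (mm (Suc n) z - mm n z) / (mm (Suc n) z - mp (Suc n) z)" for n z
  \<comment> \<open>The factor \<open>2\<close> leaves room for the division by \<open>\<kappa>\<close> below, whose modulus is at least \<open>1/2\<close>.\<close>
  define G where "G n = 2 * ((G1 n + G2 n) / b)" for n
  have G: "summable G" "\<And>n. 0 \<le> G n"
    unfolding G_def using G1 G2 b by (auto intro!: summable_mult summable_divide summable_add)
  have evd: "\<forall>\<^sub>F n in sequentially. \<forall>z\<in>K. cmod (dp n z) \<le> G n / 2 \<and> cmod (dm n z) \<le> G n / 2"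
    using G1(3) G2(3) eventually_Suc_shift[OF gap]
  proof eventually_elim
    case (elim n)
    have "cmod (dp n z) \<le> (G1 n + G2 n) / b" "cmod (dm n z) \<le> (G1 n + G2 n) / b" if "z \<in> K" for z
      unfolding dp_def dm_def norm_divide
      using that elim b G1(2)[of n] G2(2)[of n] by (force intro!: frac_le)+
    moreover have "G n / 2 = (G1 n + G2 n) / b"
      unfolding G_def by (rule nonzero_mult_div_cancel_left) simp
    ultimately show ?case by (metis (no_types))
  qed
  have evA: "\<forall>\<^sub>F n in sequentially. max (2 * Ct) (max (2 * CS) (CS * Ct / c)) \<le> A n"
    using A(2) unfolding filterlim_at_top by blast
  define \<rho> where "\<rho> n z = lm n z / lp n z" for n z
  have ev\<rho>: "\<forall>\<^sub>F n in sequentially. \<forall>z\<in>K. lp n z \<noteq> 0 \<and> lm n z \<noteq> 0 \<and>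
      cmod (\<rho> n z) \<le> 1 - c / 8 * (1 / A n) \<and> cmod (1 - \<rho> n z) \<le> 2 * CS * (1 / A n)"
    and evc: "\<forall>\<^sub>F n in sequentially. c / 8 * (1 / A n) \<le> 1"
  proof -
    show "\<forall>\<^sub>F n in sequentially. \<forall>z\<in>K. lp n z \<noteq> 0 \<and> lm n z \<noteq> 0 \<and>
      cmod (\<rho> n z) \<le> 1 - c / 8 * (1 / A n) \<and> cmod (1 - \<rho> n z) \<le> 2 * CS * (1 / A n)"
      using evA ev CS(2) Ct(2) c(3)
    proof eventually_elim
      case (elim n)
      show ?case
      proof
        fix z assume z: "z \<in> K"
        have x: "CS * Ct \<le> c * A n" "Ct \<le> A n / 2" "CS \<le> A n / 2"
          using elim(1) c(1) by (simp_all add: field_simps)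
        show "lp n z \<noteq> 0 \<and> lm n z \<noteq> 0 \<and>
          cmod (\<rho> n z) \<le> 1 - c / 8 * (1 / A n) \<and> cmod (1 - \<rho> n z) \<le> 2 * CS * (1 / A n)"
          unfolding \<rho>_def
          using eigenvalue_ratio_bounds[OF \<epsilon> A(1) c(1) elim(6)[rule_format, OF z]
              elim(4)[rule_format, OF z, unfolded S_def] elim(5)[rule_format, OF z] x(2,3,1)
              elim(2)[rule_format, OF z] elim(3)[rule_format, OF z]] by blast
      qed
    qed
    have "\<forall>\<^sub>F n in sequentially. c \<le> A n" using A(2) unfolding filterlim_at_top by blast
    then show "\<forall>\<^sub>F n in sequentially. c / 8 * (1 / A n) \<le> 1"
    proof eventually_elim
      case (elim n)
      then show ?case using A(1)[of n] by (simp add: field_simps)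
    qed
  qed
  obtain N0 where N0: "\<And>n. n \<ge> N0 \<Longrightarrow> norm (\<Sum>i. G (i + n)) < 1/4"
    using suminf_exist_split[of "1/4" G] G(1) by auto
  have "\<forall>\<^sub>F n in sequentially. n \<ge> N0 \<and> n \<ge> 1 \<and>
     (\<forall>z\<in>K. c \<le> cmod (r12 n z) \<and> c \<le> Re (csqrt (H n z)) \<and> b \<le> cmod (mm (Suc n) z - mp (Suc n) z)) \<and>
     (\<forall>z\<in>K. cmod (dp n z) \<le> G n / 2 \<and> cmod (dm n z) \<le> G n / 2) \<and>
     (\<forall>z\<in>K. lp n z \<noteq> 0 \<and> lm n z \<noteq> 0 \<and>
      cmod (\<rho> n z) \<le> 1 - c / 8 * (1 / A n) \<and> cmod (1 - \<rho> n z) \<le> 2 * CS * (1 / A n)) \<and>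
     c / 8 * (1 / A n) \<le> 1 \<and>
     (\<forall>z\<in>K. lp n z = e + (r11 n z + r22 n z) / (2 * of_real (A n)) + e * S n z / (2 * of_real (A n)) \<and>
          lm n z = e + (r11 n z + r22 n z) / (2 * of_real (A n)) - e * S n z / (2 * of_real (A n)))"
    using eventually_ge_at_top[of N0] eventually_ge_at_top[of 1] c(2,3) eventually_Suc_shift[OF gap]
      evd ev\<rho> evc ev unfolding S_def e_def
    by eventually_elim simp
  then obtain M where M: "\<And>n. n \<ge> M \<Longrightarrow> n \<ge> N0 \<and> n \<ge> 1 \<and>
     (\<forall>z\<in>K. c \<le> cmod (r12 n z) \<and> c \<le> Re (csqrt (H n z)) \<and> b \<le> cmod (mm (Suc n) z - mp (Suc n) z)) \<and>
     (\<forall>z\<in>K. cmod (dp n z) \<le> G n / 2 \<and> cmod (dm n z) \<le> G n / 2) \<and>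
     (\<forall>z\<in>K. lp n z \<noteq> 0 \<and> lm n z \<noteq> 0 \<and>
      cmod (\<rho> n z) \<le> 1 - c / 8 * (1 / A n) \<and> cmod (1 - \<rho> n z) \<le> 2 * CS * (1 / A n)) \<and>
     c / 8 * (1 / A n) \<le> 1 \<and>
     (\<forall>z\<in>K. lp n z = e + (r11 n z + r22 n z) / (2 * of_real (A n)) + e * S n z / (2 * of_real (A n)) \<and>
          lm n z = e + (r11 n z + r22 n z) / (2 * of_real (A n)) - e * S n z / (2 * of_real (A n)))"
    unfolding eventually_sequentially by blast
  have r12ne: "r12 n z \<noteq> 0" and mne: "mm (Suc n) z \<noteq> mp (Suc n) z"
    and lne: "lp n z \<noteq> 0" "lm n z \<noteq> 0" if "n \<ge> M" "z \<in> K" for n z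
    using M[OF that(1)] that(2) c(1) b by force+
  have rp: "lp n z = (e + r11 n z / of_real (A n)) + r12 n z / of_real (A n) * mp n z"
      "lp n z * mp n z = r21 n z / of_real (A n) + (e + r22 n z / of_real (A n)) * mp n z"
    if "n \<ge> M" "z \<in> K" for n z
    by (rule eigenvector_slope[OF S2[of n z] e(1) r12ne[OF that]];
        use M[OF that(1)] that(2) A(1)[of n] in \<open>simp add: mp_def\<close>)+
  have rm: "lm n z = (e + r11 n z / of_real (A n)) + r12 n z / of_real (A n) * mm n z"
      "lm n z * mm n z = r21 n z / of_real (A n) + (e + r22 n z / of_real (A n)) * mm n z"
    if "n \<ge> M" "z \<in> K" for n z
    by (rule eigenvector_slope[of "- S n z"];
        use M[OF that(1)] that(2) A(1)[of n] S2[of n z] e r12ne[OF that] in \<open>simp add: mm_def\<close>)+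
  have regS: "regular_on K (S n)" if "n \<ge> M" for n
    unfolding S_def
  proof (rule regular_on_csqrt)
    show "regular_on K (H n)"
      unfolding H_def power2_eq_square by (intro regular_on_intros reg)
    show "H n z \<notin> \<real>\<^sub>\<le>\<^sub>0" if "z \<in> K" for z
      using M[OF \<open>n \<ge> M\<close>] that c(1) unfolding Re_csqrt_pos_iff[symmetric] by fastforce
  qed
  have regl: "regular_on K (lp n)" "regular_on K (lm n)" if "n \<ge> M" for n
  proof -
    have "regular_on K (\<lambda>z. e + (r11 n z + r22 n z) / (2 * of_real (A n)) + e * S n z / (2 * of_real (A n)))"
      "regular_on K (\<lambda>z. e + (r11 n z + r22 n z) / (2 * of_real (A n)) - e * S n z / (2 * of_real (A n)))"
      using A(1)[of n] by (auto intro!: regular_on_intros regular_on_divide reg regS that)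
    then show "regular_on K (lp n)" "regular_on K (lm n)"
      using M[OF that] by (auto intro: regular_on_cong)
  qed
  have regm: "regular_on K (mp n)" "regular_on K (mm n)" if "n \<ge> M" for n
    unfolding mp_def mm_def
    using r12ne[OF that] by (auto intro!: regular_on_intros regular_on_divide reg regS that)
  have regd: "regular_on K (dp n)" "regular_on K (dm n)" "regular_on K (\<rho> n)" if "n \<ge> M" for n
    unfolding dp_def dm_def \<rho>_def
    using mne[OF that] lne[OF that] that
    by (auto intro!: regular_on_intros regular_on_divide regm regl)
  have MG: "(\<Sum>i. G (i + M)) \<le> 1/4"
    using N0[of M] M[of M] by (simp add: abs_le_iff)
  have sG: "summable (\<lambda>i. G (i + M))" using G(1) by (simp add: summable_iff_shift)
  have Gq: "G n \<le> 1/4" if "n \<ge> M" for n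
    using sum_le_suminf[OF sG, of "{n - M}"] MG G(2) that by simp
  \<comment> \<open>The determinant of the change of eigenbasis, needed to solve a step for the earlier vector.\<close>
  define \<kappa> where "\<kappa> n z = 1 + dp n z - dm n z" for n z
  have \<kappa>: "1/2 \<le> cmod (\<kappa> n z)" if "n \<ge> M" "z \<in> K" for n z
  proof -
    have "cmod (dp n z) \<le> 1/8" "cmod (dm n z) \<le> 1/8" using M[OF that(1)] that(2) Gq[OF that(1)] by force+
    then have "cmod (dp n z - dm n z) \<le> 1/4" using norm_triangle_ineq4[of "dp n z" "dm n z"] by linarith
    then show ?thesis using norm_diff_ineq[of 1 "dp n z - dm n z"] by (simp add: \<kappa>_def add_diff_eq)
  qed
  then have \<kappa>0: "\<kappa> n z \<noteq> 0" if "n \<ge> M" "z \<in> K" for n z using that by fastforce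
  have reg\<kappa>: "regular_on K (\<kappa> n)" if "n \<ge> M" for n
    unfolding \<kappa>_def by (intro regular_on_intros regd that)
  have dG: "cmod (dp (n + M) z) \<le> G (n + M)" "cmod (dm (n + M) z) \<le> G (n + M)" if "z \<in> K" for n z
    using M[of "n + M"] that G(2)[of "n + M"] by force+
  have \<rho>G: "cmod (\<rho> (n + M) z) \<le> 1 - c / 8 * (1 / A (n + M))"
    "cmod (1 - \<rho> (n + M) z) \<le> 2 * CS * (1 / A (n + M))" if "z \<in> K" for n z
    using M[of "n + M"] that by auto
  have cA: "c / 8 * (1 / A (n + M)) \<le> 1" for n using M[of "n + M"] by simp
  obtain x y where xy: "\<And>z. x 0 z = 1" "\<And>z. y 0 z = 0"
    "\<And>n z. x (Suc n) z = x n z + (dp (n + M) z * x n z + dm (n + M) z * (\<rho> (n + M) z * y n z))"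
    "\<And>n z. y (Suc n) z = \<rho> (n + M) z * y n z - (dp (n + M) z * x n z + dm (n + M) z * (\<rho> (n + M) z * y n z))"
    "unif_bv K x" "unif_bv K y" "\<And>n z. z \<in> K \<Longrightarrow> cmod (x n z - 1) \<le> 1/2"
  proof (rule dominant_solution[where G = "\<lambda>n. G (n + M)" and K = K and dp = "\<lambda>n. dp (n + M)" and
        dm = "\<lambda>n. dm (n + M)" and \<rho> = "\<lambda>n. \<rho> (n + M)" and c = "c / 8" and \<delta> = "\<lambda>n. 1 / A (n + M)" and
        C = "2 * CS", OF sG G(2) MG dG \<rho>G _ _ _ cA], goal_cases)
    case (8 x y)
    show ?case by (rule 8(1)[of x y]; fact 8(2-))
  qed (use c(1) CS(1) A(1) in \<open>simp_all add: less_imp_le\<close>)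
  define fp where "fp n z = dp (n + M) z / \<kappa> (n + M) z" for n z
  define fm where "fm n z = dm (n + M) z / \<kappa> (n + M) z" for n z
  have fG: "cmod (fp n z) \<le> G (n + M)" "cmod (fm n z) \<le> G (n + M)" if z: "z \<in> K" for n z
  proof -
    have "cmod (d / \<kappa> (n + M) z) \<le> G (n + M)" if "cmod d \<le> G (n + M) / 2" for d
    proof -
      have "cmod (d / \<kappa> (n + M) z) \<le> (G (n + M) / 2) / (1/2)"
        unfolding norm_divide using that \<kappa>[OF _ z, of "n + M"] G(2)[of "n + M"] by (intro frac_le) auto
      then show ?thesis by simp
    qed
    then show "cmod (fp n z) \<le> G (n + M)" "cmod (fm n z) \<le> G (n + M)"
      using M[of "n + M"] z by (auto simp: fp_def fm_def)
  qed
  have \<rho>1: "cmod (\<rho> (n + M) z) \<le> 1" if z: "z \<in> K" for n z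
  proof -
    have "cmod (\<rho> (n + M) z) \<le> 1 - c / 8 * (1 / A (n + M))" using M[of "n + M"] z by auto
    moreover have "0 \<le> c / 8 * (1 / A (n + M))" using c(1) A(1)[of "n + M"] by simp
    ultimately show ?thesis by linarith
  qed
  have regf: "regular_on K (fp n)" "regular_on K (fm n)" "regular_on K (\<rho> (n + M))" for n
    unfolding fp_def fm_def
    by (rule regular_on_divide[OF regd(1) reg\<kappa> \<kappa>0] regular_on_divide[OF regd(2) reg\<kappa> \<kappa>0] regd(3); simp)+
  obtain u v where uv:
    "\<And>n z. z \<in> K \<Longrightarrow> u n z = \<rho> (n + M) z * (u (Suc n) z - (fp n z * u (Suc n) z + fm n z * v (Suc n) z))"
    "\<And>n z. z \<in> K \<Longrightarrow> v n z = v (Suc n) z + (fp n z * u (Suc n) z + fm n z * v (Suc n) z)"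
    "\<And>n. regular_on K (u n)" "\<And>n. regular_on K (v n)"
    "uniform_limit K u (\<lambda>z. 0) sequentially" "uniform_limit K v (\<lambda>z. 1) sequentially"
  proof (rule recessive_solution[where \<rho> = "\<lambda>n. \<rho> (n + M)", OF sG G(2) MG fG \<rho>1 regf], goal_cases)
    case (4 u v)
    show ?case by (rule 4(1)[of u v]; fact 4(2-))
  qed
  define P where "P n z = (\<Prod>j\<in>{M..<n}. lp j z)" for n z
  define Q where "Q n z = (\<Prod>j\<in>{M..<n}. lm j z)" for n z
  have PQ: "P (Suc n) z = P n z * lp n z" "Q (Suc n) z = Q n z * lm n z" if "n \<ge> M" for n z
    using that by (simp_all add: P_def Q_def)
  have PQ0: "P n z \<noteq> 0" "Q n z \<noteq> 0" if "z \<in> K" for n z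
    using lne that by (auto simp: P_def Q_def)
  define p1 where "p1 n z = P n z * x (n - M) z + P n z * y (n - M) z" for n z
  define p2 where "p2 n z = mp n z * (P n z * x (n - M) z) + mm n z * (P n z * y (n - M) z)" for n z
  define q1 where "q1 n z = Q n z * u (n - M) z + Q n z * v (n - M) z" for n z
  define q2 where "q2 n z = mp n z * (Q n z * u (n - M) z) + mm n z * (Q n z * v (n - M) z)" for n z
  have stepp: "p1 (Suc n) z = (e + r11 n z / of_real (A n)) * p1 n z + r12 n z / of_real (A n) * p2 n z"
    "p2 (Suc n) z = r21 n z / of_real (A n) * p1 n z + (e + r22 n z / of_real (A n)) * p2 n z"
    if n: "n \<ge> M" and z: "z \<in> K" for n z
  proof -
    let ?\<theta> = "dp n z * (lp n z * (P n z * x (n - M) z)) + dm n z * (lm n z * (P n z * y (n - M) z))"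
    have lr: "lp n z * \<rho> n z = lm n z" using lne[OF n z] by (simp add: \<rho>_def)
    have 1: "P (Suc n) z * x (Suc n - M) z = lp n z * (P n z * x (n - M) z) + ?\<theta>"
      using n by (simp add: Suc_diff_le PQ xy algebra_simps flip: lr)
    have 2: "P (Suc n) z * y (Suc n - M) z = lm n z * (P n z * y (n - M) z) - ?\<theta>"
      using n by (simp add: Suc_diff_le PQ xy algebra_simps flip: lr)
    show "p1 (Suc n) z = (e + r11 n z / of_real (A n)) * p1 n z + r12 n z / of_real (A n) * p2 n z"
      "p2 (Suc n) z = r21 n z / of_real (A n) * p1 n z + (e + r22 n z / of_real (A n)) * p2 n z"
      unfolding p1_def p2_def
      by (rule eigenbasis_step[OF rp[OF n z] rm[OF n z] mne[OF n z] _ 1 2]; simp add: dp_def dm_def)+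
  qed
  have stepq: "q1 (Suc n) z = (e + r11 n z / of_real (A n)) * q1 n z + r12 n z / of_real (A n) * q2 n z"
    "q2 (Suc n) z = r21 n z / of_real (A n) * q1 n z + (e + r22 n z / of_real (A n)) * q2 n z"
    if n: "n \<ge> M" and z: "z \<in> K" for n z
  proof -
    \<comment> \<open>Solving the rank-one change of basis backward: if \<open>\<theta>'\<close> is computed from the later vector with
  the weights \<open>dp / \<kappa>\<close> and \<open>dm / \<kappa>\<close>, it equals the \<open>\<theta>\<close> computed from the earlier one.\<close>
    define s t where "s = u (Suc n - M) z" "t = v (Suc n - M) z"
    define \<theta>' where "\<theta>' = dp n z / \<kappa> n z * s + dm n z / \<kappa> n z * t"
    have u: "u (n - M) z = \<rho> n z * (s - \<theta>')" and v: "v (n - M) z = t + \<theta>'"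
      using uv(1,2)[OF z, of "n - M"] n by (simp_all add: s_t_def \<theta>'_def fp_def fm_def Suc_diff_le)
    let ?\<theta> = "dp n z * (lp n z * (Q n z * u (n - M) z)) + dm n z * (lm n z * (Q n z * v (n - M) z))"
    have lr: "lp n z * \<rho> n z = lm n z" using lne[OF n z] by (simp add: \<rho>_def)
    have "\<kappa> n z * \<theta>' = dp n z * s + dm n z * t"
      using \<kappa>0[OF n z] by (simp add: \<theta>'_def field_simps)
    then have "dp n z * (s - \<theta>') + dm n z * (t + \<theta>') = \<theta>'"
      by (simp add: \<kappa>_def algebra_simps)
    moreover have "?\<theta> = Q n z * lm n z * (dp n z * (s - \<theta>') + dm n z * (t + \<theta>'))"
      unfolding u v by (simp add: algebra_simps flip: lr)
    ultimately have \<theta>: "?\<theta> = Q n z * lm n z * \<theta>'" by simp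
    have 1: "Q (Suc n) z * u (Suc n - M) z = lp n z * (Q n z * u (n - M) z) + ?\<theta>"
      unfolding \<theta> unfolding u s_t_def[symmetric] PQ[OF n] by (simp add: algebra_simps flip: lr)
    have 2: "Q (Suc n) z * v (Suc n - M) z = lm n z * (Q n z * v (n - M) z) - ?\<theta>"
      unfolding \<theta> unfolding v s_t_def[symmetric] PQ[OF n] by (simp add: algebra_simps)
    show "q1 (Suc n) z = (e + r11 n z / of_real (A n)) * q1 n z + r12 n z / of_real (A n) * q2 n z"
      "q2 (Suc n) z = r21 n z / of_real (A n) * q1 n z + (e + r22 n z / of_real (A n)) * q2 n z"
      unfolding q1_def q2_def
      by (rule eigenbasis_step[OF rp[OF n z] rm[OF n z] mne[OF n z] _ 1 2]; simp add: dp_def dm_def)+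
  qed
  have PM: "P M = (\<lambda>z. 1)" "Q M = (\<lambda>z. 1)" by (auto simp: P_def Q_def)
  have regM: "regular_on K (p1 M)" "regular_on K (p2 M)" "regular_on K (q1 M)" "regular_on K (q2 M)"
    unfolding p1_def p2_def q1_def q2_def PM
    by (auto simp: xy intro!: regular_on_intros regm uv)
  obtain X where X: "uniform_limit K x X sequentially" "bounded (X ` K)"
    using xy(5) by (rule unif_bv_uniform_limit)
  obtain Y where Y: "uniform_limit K y Y sequentially" "bounded (Y ` K)"
    using xy(6) by (rule unif_bv_uniform_limit)
  obtain Mp where Mp: "uniform_limit K mp Mp sequentially" "bounded (Mp ` K)"
    using bvm(1) by (rule unif_bv_uniform_limit)
  obtain Mm where Mm: "uniform_limit K mm Mm sequentially" "bounded (Mm ` K)"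
    using bvm(2) by (rule unif_bv_uniform_limit)
  note lims = X(1) Y(1) uv(5,6)
  note lims' = lims[THEN uniform_limit_minus_nat[of _ _ _ M]]
  have bd01: "bounded ((\<lambda>z. 0::complex) ` K)" "bounded ((\<lambda>z. 1::complex) ` K)"
    by (auto simp: bounded_iff)
  have L: "uniform_limit K (\<lambda>n z. x (n - M) z + y (n - M) z) (\<lambda>z. X z + Y z) sequentially"
    "uniform_limit K (\<lambda>n z. mp n z * x (n - M) z + mm n z * y (n - M) z) (\<lambda>z. Mp z * X z + Mm z * Y z) sequentially"
    "uniform_limit K (\<lambda>n z. u (n - M) z + v (n - M) z) (\<lambda>z. 0 + 1) sequentially"
    "uniform_limit K (\<lambda>n z. mp n z * u (n - M) z + mm n z * v (n - M) z) (\<lambda>z. Mp z * 0 + Mm z * 1) sequentially"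
    by (intro uniform_limit_add uniform_lim_mult lims' Mp Mm X(2) Y(2) bd01)+
  have bdd: "bounded ((\<lambda>z. X z + Y z) ` K)" "bounded ((\<lambda>z. Mp z * X z + Mm z * Y z) ` K)"
    "bounded ((\<lambda>z. 0 + 1 :: complex) ` K)" "bounded ((\<lambda>z. Mp z * 0 + Mm z * 1) ` K)"
    using X(2) Y(2) Mp(2) Mm(2) bd01
    by (auto intro!: bounded_plus_comp bounded_image_mult)
  have fin: "uniform_limit K (\<lambda>n z. p1 n z / P n z) (\<lambda>z. X z + Y z) sequentially"
    "uniform_limit K (\<lambda>n z. p2 n z / P n z) (\<lambda>z. Mp z * X z + Mm z * Y z) sequentially"
    "uniform_limit K (\<lambda>n z. q1 n z / Q n z) (\<lambda>z. 0 + 1) sequentially"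
    "uniform_limit K (\<lambda>n z. q2 n z / Q n z) (\<lambda>z. Mp z * 0 + Mm z * 1) sequentially"
    by (rule uniform_limit_cong'[THEN iffD1, OF _ _ L(1)] uniform_limit_cong'[THEN iffD1, OF _ _ L(2)]
          uniform_limit_cong'[THEN iffD1, OF _ _ L(3)] uniform_limit_cong'[THEN iffD1, OF _ _ L(4)];
        use PQ0 in \<open>simp add: p1_def p2_def q1_def q2_def field_simps\<close>)+
  have det: "(X z + Y z) * (Mp z * 0 + Mm z * 1) \<noteq> (Mp z * X z + Mm z * Y z) * (0 + 1)" if z: "z \<in> K" for z
  proof -
    have "(\<lambda>n. cmod (mm n z - mp n z)) \<longlonglongrightarrow> cmod (Mm z - Mp z)"
      by (intro tendsto_intros tendsto_uniform_limitI[OF Mm(1) z] tendsto_uniform_limitI[OF Mp(1) z])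
    then have "b \<le> cmod (Mm z - Mp z)"
      by (rule tendsto_lowerbound) (use gap z in \<open>auto elim: eventually_mono\<close>)
    then have "Mm z - Mp z \<noteq> 0" using b by auto
    moreover have "cmod (X z - 1) \<le> 1/2"
    proof (rule tendsto_upperbound)
      show "(\<lambda>n. cmod (x n z - 1)) \<longlonglongrightarrow> cmod (X z - 1)"
        by (intro tendsto_intros tendsto_uniform_limitI[OF X(1) z])
    qed (use xy(7)[OF z] in auto)
    then have "X z \<noteq> 0" by auto
    ultimately have "X z * (Mm z - Mp z) \<noteq> 0" by simp
    then show ?thesis by (simp add: algebra_simps)
  qed
  have M1: "1 \<le> M" using M[of M] by simp
  note fin' = fin[unfolded P_def Q_def]
  note step' = stepp[unfolded e_def] stepq[unfolded e_def]
  show ?thesis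
    by (rule exI[of _ M], rule conjI[OF M1], rule exI[of _ p1], rule exI[of _ p2], rule exI[of _ q1],
        rule exI[of _ q2], rule exI[of _ "\<lambda>z. X z + Y z"], rule exI[of _ "\<lambda>z. Mp z * X z + Mm z * Y z"],
        rule exI[of _ "\<lambda>z. 0 + 1"], rule exI[of _ "\<lambda>z. Mp z * 0 + Mm z * 1"],
        intro conjI allI impI ballI; (rule fin' regM bdd | (rule step' lne det; assumption)))
qed

section \<open>Transfer matrices of periodically modulated parameters\<close>

lemma transfer_nth:
  "transfer a b n z $ 1 $ 1 = 0" "transfer a b n z $ 1 $ 2 = 1"
  "transfer a b n z $ 2 $ 1 = - complex_of_real ((if n = 0 then 1 else a (n - 1)) / a n)"
  "transfer a b n z $ 2 $ 2 = (z - complex_of_real (b n)) / complex_of_real (a n)"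
  by (simp_all add: transfer_def)

lemma transfer_periodic_nth:
  "transfer_periodic \<alpha> \<beta> j z $ 1 $ 1 = 0" "transfer_periodic \<alpha> \<beta> j z $ 1 $ 2 = 1"
  "transfer_periodic \<alpha> \<beta> j z $ 2 $ 1 = - complex_of_real (\<alpha> (j - 1) / \<alpha> j)"
  "transfer_periodic \<alpha> \<beta> j z $ 2 $ 2 = (z - complex_of_real (\<beta> j)) / complex_of_real (\<alpha> j)"
  by (simp_all add: transfer_periodic_def)

lemma matrix_mult_nth_2: "((X :: complex^2^2) ** Y) $ i $ k = X $ i $ 1 * Y $ 1 $ k + X $ i $ 2 * Y $ 2 $ k"
  by (simp add: matrix_matrix_mult_def sum_2)

lemma matrix_vector_mult_nth_2: "((X :: complex^2^2) *v v) $ i = X $ i $ 1 * v $ 1 + X $ i $ 2 * v $ 2"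
  by (simp add: matrix_vector_mult_def sum_2)

lemma unif_bv_tendsto_imp_uniform_limit:
  assumes "unif_bv K f" "\<And>z. z \<in> K \<Longrightarrow> (\<lambda>n. f n z) \<longlonglongrightarrow> g z"
  shows "uniform_limit K f g sequentially" "bounded (g ` K)"
proof -
  obtain l where l: "uniform_limit K f l sequentially" "bounded (l ` K)"
    using assms(1) by (rule unif_bv_uniform_limit)
  have eq: "l z = g z" if "z \<in> K" for z
    using LIMSEQ_unique[OF tendsto_uniform_limitI[OF l(1) that] assms(2)[OF that]] .
  show "uniform_limit K f g sequentially"
    using l(1) eq by (simp cong: uniform_limit_cong')
  show "bounded (g ` K)"
    using l(2) eq by (simp cong: image_cong)
qed

text \<open>The standing assumptions on the parameters, with \<open>K\<close> an arbitrary compact set.\<close>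

locale modulated_parameters =
  fixes N :: nat and a b :: "nat \<Rightarrow> real" and \<alpha> \<beta> :: "int \<Rightarrow> real" and \<epsilon> :: real and K :: "complex set"
  assumes N: "N \<ge> 1"
    and a_pos: "\<And>n. a n > 0"
    and modulated: "periodically_modulated N \<alpha> \<beta> a b"
    and \<epsilon>: "\<epsilon> \<in> {-1, 1}"
    and monodromy_0: "monodromy_periodic \<alpha> \<beta> N 0 0 = \<epsilon> *\<^sub>R mat 1"
    and bv_ratio: "bounded_variation_class N
           (\<lambda>n. a (Suc n) * (\<alpha> (int n) / \<alpha> (int (Suc n)) - a n / a (Suc n)))"
    and bv_diag: "bounded_variation_class N (\<lambda>n. a n * (\<beta> (int n) / \<alpha> (int n) - b n / a n))"
    and bv_inv: "bounded_variation_class N (\<lambda>n. 1 / a n)"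
    and K: "compact K"
begin

text \<open>\<open>a\<^sub>n\<^sub>-\<^sub>1\<close> with the convention \<open>a\<^sub>-\<^sub>1 = 1\<close> built into \<open>B\<^sub>0\<close>.\<close>

definition prev :: "nat \<Rightarrow> real" where
  "prev n = (if n = 0 then 1 else a (n - 1))"

text \<open>The number by which \<open>X\<^sub>j\<^sub>N - \<epsilon>\<close> has to be multiplied to obtain a nontrivial limit.\<close>

definition scale :: "nat \<Rightarrow> real" where
  "scale j = a (j * N + N - 1)"

definition partial :: "nat \<Rightarrow> nat \<Rightarrow> complex \<Rightarrow> complex^2^2" where
  "partial j i z = left_prod (\<lambda>k. transfer a b (j * N + k) z) i"

text \<open>The limit of \<open>partial j i z\<close> as \<open>j \<rightarrow> \<infinity>\<close>, which is the same for all \<open>z\<close> because \<open>a\<^sub>n \<rightarrow> \<infinity>\<close>.\<close>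

definition partial0 :: "nat \<Rightarrow> complex^2^2" where
  "partial0 i = left_prod (\<lambda>k. transfer_periodic \<alpha> \<beta> (int k) 0) i"

lemma partial_simps:
  "partial j 0 z = mat 1" "partial j (Suc i) z = transfer a b (j * N + i) z ** partial j i z"
  by (simp_all add: partial_def)

lemma partial0_simps:
  "partial0 0 = mat 1" "partial0 (Suc i) = transfer_periodic \<alpha> \<beta> (int i) 0 ** partial0 i"
  by (simp_all add: partial0_def)

lemma monodromy_eq_partial: "monodromy a b N (j * N) z = partial j N z"
  by (simp add: monodromy_def partial_def)

lemma partial0_N: "partial0 N = \<epsilon> *\<^sub>R mat 1"
  using monodromy_0 by (simp add: monodromy_periodic_def partial0_def)

lemma prev_pos: "prev n > 0"
  by (simp add: prev_def a_pos)

lemma scale_pos: "scale j > 0"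
  by (simp add: scale_def a_pos)

lemma prev_period: "prev (j * N + N) = scale j"
  using N by (simp add: prev_def scale_def)

lemma \<alpha>_pos: "\<alpha> n > 0"
  using modulated by (simp add: periodically_modulated_def)

lemma periodic: "\<alpha> (k + int (j * N)) = \<alpha> k" "\<beta> (k + int (j * N)) = \<beta> k"
proof -
  have "\<alpha> (n + int N) = \<alpha> n" "\<beta> (n + int N) = \<beta> n" for n
    using modulated by (simp_all add: periodically_modulated_def)
  note per = this
  have *: "k + int (Suc j * N) = (k + int (j * N)) + int N" for j by simp
  show "\<alpha> (k + int (j * N)) = \<alpha> k"
  proof (induction j)
    case (Suc j)
    then show ?case unfolding * per .
  qed simp
  show "\<beta> (k + int (j * N)) = \<beta> k"
  proof (induction j)
    case (Suc j)
    then show ?case unfolding * per .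
  qed simp
qed

lemma periodic_index:
  "\<alpha> (int (j * N + i)) = \<alpha> (int i)" "\<beta> (int (j * N + i)) = \<beta> (int i)"
  "\<alpha> (int (j * N + i) - 1) = \<alpha> (int i - 1)"
  using periodic[of "int i" j] periodic[of "int i - 1" j] by (simp_all add: algebra_simps)

lemma filterlim_block_index: "filterlim (\<lambda>j. j * N + i) at_top sequentially"
proof (rule filterlim_at_top_mono[OF filterlim_ident])
  show "\<forall>\<^sub>F j in sequentially. j \<le> j * N + i"
    using N by (intro always_eventually) (simp add: trans_le_add1)
qed

lemma scale_at_top: "filterlim scale at_top sequentially"
proof -
  have "filterlim a at_top sequentially" using modulated by (simp add: periodically_modulated_def)
  then have "filterlim (\<lambda>j. a (j * N + (N - 1))) at_top sequentially"
    by (rule filterlim_compose[OF _ filterlim_block_index])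
  then show ?thesis using N by (simp add: scale_def[abs_def])
qed

lemma bv_inverse_a: "unif_bv K (\<lambda>j z. complex_of_real (1 / a (j * N + i)))"
  using bv_inv N by (rule unif_bv_subsequence)

lemma bv_r: "unif_bv K (\<lambda>j z. complex_of_real (a (j * N + i) * (\<beta> (int i) / \<alpha> (int i) - b (j * N + i) / a (j * N + i))))"
  using unif_bv_subsequence[OF bv_diag N, of K i] unfolding periodic_index .

lemma Suc_block_index: "Suc j * N + i = Suc (j * N + (N + i - 1))"
  using N by simp

text \<open>For \<open>j \<ge> 1\<close> these are values of the sequence \<open>a\<^sub>n (\<alpha>\<^sub>n\<^sub>-\<^sub>1 / \<alpha>\<^sub>n - a\<^sub>n\<^sub>-\<^sub>1 / a\<^sub>n)\<close> along a residue class.\<close>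

lemma bv_s: "unif_bv K (\<lambda>j z. complex_of_real (a (j * N + i) *
    (\<alpha> (int i - 1) / \<alpha> (int i) - prev (j * N + i) / a (j * N + i))))"
proof (rule unif_bv_Suc_imp)
  have "a (Suc j * N + i) * (\<alpha> (int i - 1) / \<alpha> (int i) - prev (Suc j * N + i) / a (Suc j * N + i))
     = (let n = j * N + (N + i - 1) in a (Suc n) * (\<alpha> (int n) / \<alpha> (int (Suc n)) - a n / a (Suc n)))" for j
    using periodic_index[of "Suc j" i] unfolding Suc_block_index Let_def prev_def by simp
  then show "unif_bv K (\<lambda>j z. complex_of_real (a (Suc j * N + i) *
    (\<alpha> (int i - 1) / \<alpha> (int i) - prev (Suc j * N + i) / a (Suc j * N + i))))"
    using unif_bv_subsequence[OF bv_ratio N, of K "N + i - 1"] by (simp only: Let_def)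
qed

lemma bounded_K: "\<exists>B. \<forall>z\<in>K. cmod z \<le> B"
  using compact_imp_bounded[OF K] by (simp add: bounded_iff)

lemma bv_ident: "unif_bv K (\<lambda>j z. z)"
  using bounded_K by (auto intro: unif_bv_const)

lemma bv_constant: "unif_bv K (\<lambda>j z. c)"
  by (rule unif_bv_const[of _ _ "cmod c"]) simp

lemma bv_prev_ratio: "unif_bv K (\<lambda>j z. complex_of_real (prev (j * N + i) / a (j * N + i)))"
proof -
  have "unif_bv K (\<lambda>j z. complex_of_real (\<alpha> (int i - 1) / \<alpha> (int i)) - complex_of_real (a (j * N + i) *
    (\<alpha> (int i - 1) / \<alpha> (int i) - prev (j * N + i) / a (j * N + i))) * complex_of_real (1 / a (j * N + i)))"
    by (intro unif_bv_diff bv_constant unif_bv_mult bv_s bv_inverse_a)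
  moreover have "complex_of_real (\<alpha> (int i - 1) / \<alpha> (int i)) - complex_of_real (a (j * N + i) *
      (\<alpha> (int i - 1) / \<alpha> (int i) - prev (j * N + i) / a (j * N + i))) * complex_of_real (1 / a (j * N + i))
      = (complex_of_real (prev (j * N + i) / a (j * N + i)) :: complex)" for j
    unfolding of_real_mult[symmetric] of_real_diff[symmetric] of_real_eq_iff
    using a_pos[of "j * N + i"] by simp
  ultimately show ?thesis by (simp only:)
qed

lemma bv_transfer: "unif_bv K (\<lambda>j z. transfer a b (j * N + i) z $ k $ l)"
proof -
  have 22: "unif_bv K (\<lambda>j z. transfer a b (j * N + i) z $ 2 $ 2)"
  proof -
    have "unif_bv K (\<lambda>j z. z * complex_of_real (1 / a (j * N + i)) + (complex_of_real (a (j * N + i) *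
        (\<beta> (int i) / \<alpha> (int i) - b (j * N + i) / a (j * N + i))) * complex_of_real (1 / a (j * N + i))
         - complex_of_real (\<beta> (int i) / \<alpha> (int i))))"
      by (intro unif_bv_add unif_bv_diff bv_constant unif_bv_mult bv_r bv_inverse_a bv_ident)
    moreover have "complex_of_real (a (j * N + i) *
        (\<beta> (int i) / \<alpha> (int i) - b (j * N + i) / a (j * N + i))) * complex_of_real (1 / a (j * N + i))
         - complex_of_real (\<beta> (int i) / \<alpha> (int i)) = (- complex_of_real (b (j * N + i) / a (j * N + i)) :: complex)" for j
      unfolding of_real_mult[symmetric] of_real_diff[symmetric] of_real_minus[symmetric] of_real_eq_iff
      using a_pos[of "j * N + i"] by simp
    ultimately show ?thesis
      by (simp add: transfer_nth diff_divide_distrib)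
  qed
  have 21: "unif_bv K (\<lambda>j z. transfer a b (j * N + i) z $ 2 $ 1)"
    using unif_bv_cmult[OF bv_prev_ratio[of i], of "-1"]
    by (simp add: transfer_nth prev_def)
  have "unif_bv K (\<lambda>j z. transfer a b (j * N + i) z $ 1 $ l)" for l
    using exhaust_2[of l] bv_constant by (auto simp: transfer_nth)
  note 1 = this
  consider "k = 1" | "k = 2" "l = 1" | "k = 2" "l = 2"
    using exhaust_2[of k] exhaust_2[of l] by blast
  then show ?thesis
    by cases (simp_all only: 1 21 22)
qed

lemma bv_partial: "unif_bv K (\<lambda>j z. partial j i z $ k $ l)"
proof (induction i arbitrary: k l)
  case 0
  show ?case by (simp add: partial_simps bv_constant)
next
  case (Suc i)
  show ?case unfolding partial_simps matrix_mult_nth_2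
    by (intro unif_bv_add unif_bv_mult bv_transfer Suc)
qed

lemma prev_ratio_tendsto: "(\<lambda>j. prev (j * N + i) / a (j * N + i)) \<longlonglongrightarrow> \<alpha> (int i - 1) / \<alpha> (int i)"
proof (rule LIMSEQ_imp_Suc)
  have "(\<lambda>n. a n / a (Suc n) - \<alpha> (int n) / \<alpha> (int (Suc n))) \<longlonglongrightarrow> 0"
    using modulated by (simp add: periodically_modulated_def)
  then have "(\<lambda>j. let n = j * N + (N + i - 1) in a n / a (Suc n) - \<alpha> (int n) / \<alpha> (int (Suc n))) \<longlonglongrightarrow> 0"
    unfolding Let_def by (rule filterlim_compose[OF _ filterlim_block_index])
  moreover have "(let n = j * N + (N + i - 1) in a n / a (Suc n) - \<alpha> (int n) / \<alpha> (int (Suc n)))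
     = prev (Suc j * N + i) / a (Suc j * N + i) - \<alpha> (int i - 1) / \<alpha> (int i)" for j
    using periodic_index[of "Suc j" i] unfolding Suc_block_index Let_def prev_def by simp
  ultimately show "(\<lambda>j. prev (Suc j * N + i) / a (Suc j * N + i)) \<longlonglongrightarrow> \<alpha> (int i - 1) / \<alpha> (int i)"
    by (simp only: LIM_zero_iff)
qed

text \<open>Each quotient of consecutive \<open>a\<^sub>n\<close> has bounded variation and a positive limit, so its inverse has
bounded variation too.\<close>

lemma bv_a_quotient: "unif_bv K (\<lambda>j z. complex_of_real (a (j * N + i + m) / a (j * N + i)))"
proof (induction m)
  case 0
  have "a (j * N + i + 0) / a (j * N + i) = 1" for j using a_pos[of "j * N + i"] by simp
  then show ?case by (simp only: of_real_1 bv_constant)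
next
  case (Suc m)
  let ?c = "\<alpha> (int (i + Suc m) - 1) / \<alpha> (int (i + Suc m))"
  have c: "?c > 0" using \<alpha>_pos by simp
  have ge: "u \<le> cmod (complex_of_real x)" if "u < x" for u x :: real
    using that by (simp add: less_imp_le less_le_trans[OF that abs_ge_self])
  have half: "x / 2 < x" if "x > 0" for x :: real using that by simp
  have "\<forall>\<^sub>F j in sequentially. ?c / 2 < prev (j * N + (i + Suc m)) / a (j * N + (i + Suc m))"
    by (rule order_tendstoD(1)[OF prev_ratio_tendsto]) (rule half[OF c])
  then have "\<forall>\<^sub>F j in sequentially. \<forall>z\<in>K. ?c / 2 \<le> cmod (complex_of_real (prev (j * N + (i + Suc m)) / a (j * N + (i + Suc m))))"
    by eventually_elim (blast intro: ge)
  then have "unif_bv K (\<lambda>j z. inverse (complex_of_real (prev (j * N + (i + Suc m)) / a (j * N + (i + Suc m)))))"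
    using c by (intro unif_bv_inverse[OF bv_prev_ratio, of "?c / 2"]) auto
  then have "unif_bv K (\<lambda>j z. complex_of_real (a (j * N + i + m) / a (j * N + i)) *
       inverse (complex_of_real (prev (j * N + (i + Suc m)) / a (j * N + (i + Suc m)))))"
    by (intro unif_bv_mult Suc)
  moreover have "complex_of_real (a (j * N + i + m) / a (j * N + i)) *
       inverse (complex_of_real (prev (j * N + (i + Suc m)) / a (j * N + (i + Suc m))))
     = (complex_of_real (a (j * N + i + Suc m) / a (j * N + i)) :: complex)" for j
    unfolding of_real_mult[symmetric] of_real_inverse[symmetric] of_real_eq_iff
    using a_pos[of "j * N + (i + m)"] by (simp add: prev_def add.assoc)
  ultimately show ?case by (simp only:)
qed

text \<open>The entries of \<open>B\<^sub>n(z) - \<BB>\<^sub>n(0)\<close> times \<open>a\<^sub>n\<close> are the sequences of the hypotheses, up to the summand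
\<open>z\<close>; passing from \<open>a\<^sub>n\<close> to the last \<open>a\<close> of the block costs only a quotient as above.\<close>

lemma bv_scaled_transfer:
  assumes "i < N"
  shows "unif_bv K (\<lambda>j z. complex_of_real (scale j) *
    (transfer a b (j * N + i) z $ k $ l - transfer_periodic \<alpha> \<beta> (int i) 0 $ k $ l))"
proof -
  have eq: "scale j = a (j * N + i + (N - 1 - i))" for j
    using assms by (simp add: scale_def)
  have q: "unif_bv K (\<lambda>j z. complex_of_real (scale j / a (j * N + i)))"
    unfolding eq by (rule bv_a_quotient)
  have 22: "unif_bv K (\<lambda>j z. complex_of_real (scale j) *
    (transfer a b (j * N + i) z $ 2 $ 2 - transfer_periodic \<alpha> \<beta> (int i) 0 $ 2 $ 2))"
  proof -
    have "unif_bv K (\<lambda>j z. complex_of_real (scale j / a (j * N + i)) * (z + complex_of_real (a (j * N + i) *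
      (\<beta> (int i) / \<alpha> (int i) - b (j * N + i) / a (j * N + i)))))"
      by (intro unif_bv_mult unif_bv_add q bv_ident bv_r)
    moreover have "complex_of_real (scale j) *
       (transfer a b (j * N + i) z $ 2 $ 2 - transfer_periodic \<alpha> \<beta> (int i) 0 $ 2 $ 2)
      = complex_of_real (scale j / a (j * N + i)) * (z + complex_of_real (a (j * N + i) *
      (\<beta> (int i) / \<alpha> (int i) - b (j * N + i) / a (j * N + i))))" for j z
      using a_pos[of "j * N + i"] \<alpha>_pos[of "int i"]
      by (simp add: transfer_nth transfer_periodic_nth field_simps)
    ultimately show ?thesis by (simp only:)
  qed
  have 21: "unif_bv K (\<lambda>j z. complex_of_real (scale j) *
    (transfer a b (j * N + i) z $ 2 $ 1 - transfer_periodic \<alpha> \<beta> (int i) 0 $ 2 $ 1))"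
  proof -
    have "unif_bv K (\<lambda>j z. complex_of_real (scale j / a (j * N + i)) * complex_of_real (a (j * N + i) *
      (\<alpha> (int i - 1) / \<alpha> (int i) - prev (j * N + i) / a (j * N + i))))"
      by (intro unif_bv_mult q bv_s)
    moreover have "complex_of_real (scale j) *
       (transfer a b (j * N + i) z $ 2 $ 1 - transfer_periodic \<alpha> \<beta> (int i) 0 $ 2 $ 1)
      = complex_of_real (scale j / a (j * N + i)) * complex_of_real (a (j * N + i) *
      (\<alpha> (int i - 1) / \<alpha> (int i) - prev (j * N + i) / a (j * N + i)))" for j z
      using a_pos[of "j * N + i"]
      unfolding transfer_nth transfer_periodic_nth prev_def[symmetric] of_real_mult[symmetric]
        of_real_diff[symmetric] of_real_minus[symmetric] of_real_eq_iff
      by (simp add: field_simps)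
    ultimately show ?thesis by (simp only:)
  qed
  have "unif_bv K (\<lambda>j z. complex_of_real (scale j) *
    (transfer a b (j * N + i) z $ 1 $ l - transfer_periodic \<alpha> \<beta> (int i) 0 $ 1 $ l))" for l
    using exhaust_2[of l] bv_constant by (auto simp: transfer_nth transfer_periodic_nth)
  note 1 = this
  consider "k = 1" | "k = 2" "l = 1" | "k = 2" "l = 2"
    using exhaust_2[of k] exhaust_2[of l] by blast
  then show ?thesis
    by cases (simp_all only: 1 21 22)
qed

text \<open>By the product rule \<open>F P - F\<^sub>0 P\<^sub>0 = (F - F\<^sub>0) P + F\<^sub>0 (P - P\<^sub>0)\<close>, along the factors of a block.\<close>

lemma bv_scaled_partial:
  assumes "i \<le> N"
  shows "unif_bv K (\<lambda>j z. complex_of_real (scale j) * (partial j i z $ k $ l - partial0 i $ k $ l))"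
  using assms
proof (induction i arbitrary: k l)
  case 0
  show ?case by (simp add: partial_simps partial0_simps bv_constant)
next
  case (Suc i)
  define T0 where "T0 = transfer_periodic \<alpha> \<beta> (int i) 0"
  define E where "E m j z = complex_of_real (scale j) * (transfer a b (j * N + i) z $ k $ m - T0 $ k $ m)" for m j z
  define D where "D m j z = complex_of_real (scale j) * (partial j i z $ m $ l - partial0 i $ m $ l)" for m j z
  have "complex_of_real (scale j) * (partial j (Suc i) z $ k $ l - partial0 (Suc i) $ k $ l)
    = E 1 j z * partial j i z $ 1 $ l + E 2 j z * partial j i z $ 2 $ l
      + (T0 $ k $ 1 * D 1 j z + T0 $ k $ 2 * D 2 j z)" for j z
    unfolding partial_simps partial0_simps matrix_mult_nth_2 E_def D_def T0_def[symmetric]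
    by (simp add: algebra_simps)
  moreover have "unif_bv K (E m)" "unif_bv K (D m)" for m
    using Suc bv_scaled_transfer[of i k m] unfolding E_def D_def T0_def by simp_all
  then have "unif_bv K (\<lambda>j z. E 1 j z * partial j i z $ 1 $ l + E 2 j z * partial j i z $ 2 $ l
      + (T0 $ k $ 1 * D 1 j z + T0 $ k $ 2 * D 2 j z))"
    by (intro unif_bv_add unif_bv_cmult unif_bv_mult bv_partial)
  ultimately show ?case by (simp only:)
qed

text \<open>The Christoffel-Darboux identity for the solution that is \<open>(0, 1)\<close> at the start of the block.\<close>

lemma Christoffel_Darboux:
  "prev (j * N + i) * Im (partial j i z $ 2 $ 2 * cnj (partial j i z $ 1 $ 2))
    = Im z * (\<Sum>k<i. (cmod (partial j k z $ 2 $ 2))\<^sup>2)"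
proof (induction i)
  case 0
  show ?case by (simp add: partial_simps mat_def)
next
  case (Suc i)
  have Im_eq: "x * Im u = y * Im v + Im z * t"
    if "of_real x * u = of_real y * v + (z - of_real w) * of_real t" for x y w t :: real and u v
    using arg_cong[OF that, of Im] by simp
  define q p where "q = partial j i z $ 1 $ 2" "p = partial j i z $ 2 $ 2"
  define n where "n = j * N + i"
  have q': "partial j (Suc i) z $ 1 $ 2 = p"
    by (simp add: partial_simps matrix_mult_nth_2 transfer_nth q_p_def)
  have "partial j (Suc i) z $ 2 $ 2 = - complex_of_real (prev n / a n) * q + (z - complex_of_real (b n)) / complex_of_real (a n) * p"
    by (simp add: partial_simps matrix_mult_nth_2 transfer_nth q_p_def n_def prev_def)
  moreover have "complex_of_real (a n) * (- complex_of_real (prev n / a n) * q + (z - complex_of_real (b n)) / complex_of_real (a n) * p)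
      = - complex_of_real (prev n) * q + (z - complex_of_real (b n)) * p"
    using a_pos[of n] by (simp add: right_diff_distrib)
  ultimately have "complex_of_real (a n) * partial j (Suc i) z $ 2 $ 2
      = - complex_of_real (prev n) * q + (z - complex_of_real (b n)) * p"
    by simp
  then have "complex_of_real (a n) * (partial j (Suc i) z $ 2 $ 2 * cnj p)
      = (- complex_of_real (prev n) * q + (z - complex_of_real (b n)) * p) * cnj p"
    unfolding mult.assoc[symmetric] by (simp only:)
  also have "\<dots> = complex_of_real (prev n) * - (q * cnj p) + (z - complex_of_real (b n)) * (p * cnj p)"
    by (simp add: algebra_simps)
  also have "p * cnj p = complex_of_real ((cmod p)\<^sup>2)"
    by (rule complex_norm_square[symmetric])
  finally have "a n * Im (partial j (Suc i) z $ 2 $ 2 * cnj p)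
      = prev n * Im (- (q * cnj p)) + Im z * (cmod p)\<^sup>2"
    by (rule Im_eq)
  moreover have "Im (- (q * cnj p)) = Im (p * cnj q)" by simp
  moreover have "prev (j * N + Suc i) = a n" by (simp add: prev_def n_def)
  ultimately show ?case
    using Suc unfolding q' q_p_def[symmetric] n_def[symmetric] by (simp add: algebra_simps q_p_def)
qed

lemma det_partial: "det (partial j i z) = complex_of_real (prev (j * N) / prev (j * N + i))"
proof (induction i)
  case 0
  show ?case using prev_pos[of "j * N"] by (simp add: partial_simps)
next
  case (Suc i)
  have "det (transfer a b (j * N + i) z) = complex_of_real (prev (j * N + i) / a (j * N + i))"
    by (simp add: det_2 transfer_nth prev_def)
  moreover have "prev (j * N + Suc i) = a (j * N + i)" by (simp add: prev_def)
  ultimately show ?case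
    using Suc prev_pos[of "j * N + i"] by (simp add: partial_simps det_mul)
qed

lemma regular_partial: "regular_on K (\<lambda>z. partial j i z $ k $ l)"
proof (induction i arbitrary: k l)
  case 0
  show ?case by (simp add: partial_simps regular_on_const)
next
  case (Suc i)
  have "regular_on K (\<lambda>z. transfer a b n z $ k $ l)" for n k l
    using exhaust_2[of k] exhaust_2[of l] a_pos[of n]
    by (auto simp: transfer_nth intro!: regular_on_intros regular_on_divide)
  then show ?case unfolding partial_simps matrix_mult_nth_2
    by (intro regular_on_intros Suc)
qed

section \<open>The scaled monodromy matrices\<close>

text \<open>The entries of \<open>R\<^sub>j\<close> in \<open>X\<^sub>j\<^sub>N(z) = \<epsilon> + R\<^sub>j(z) / scale j\<close>.\<close>

definition residual :: "2 \<Rightarrow> 2 \<Rightarrow> nat \<Rightarrow> complex \<Rightarrow> complex" where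
  "residual k l j z = of_real (scale j) * (partial j N z $ k $ l - partial0 N $ k $ l)"

text \<open>The discriminant of \<open>R\<^sub>j\<close>; its limit is \<open>h\<close>.\<close>

definition scaled_discr :: "nat \<Rightarrow> complex \<Rightarrow> complex" where
  "scaled_discr j z = (residual 1 1 j z - residual 2 2 j z)\<^sup>2 + 4 * residual 1 2 j z * residual 2 1 j z"

lemma partial0_N_nth: "partial0 N $ k $ l = (if k = l then of_real \<epsilon> else 0)"
  unfolding partial0_N by (simp add: mat_def of_real_def)

lemma bv_residual: "unif_bv K (residual k l)"
  unfolding residual_def by (rule bv_scaled_partial) simp

lemma regular_residual: "regular_on K (residual k l j)"
  unfolding residual_def by (intro regular_on_intros regular_partial)

lemma partial_N_nth:
  "partial j N z $ k $ l = (if k = l then of_real \<epsilon> else 0) + residual k l j z / of_real (scale j)"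
  using scale_pos[of j] by (simp add: residual_def partial0_N_nth)

lemma scaled_discr_eq: "scaled_discr j z = (of_real (scale j))\<^sup>2 * discr (partial j N z)"
  unfolding scaled_discr_def residual_def discr_def trace_def det_2 sum_2 partial0_N_nth
  by (simp add: power2_eq_square algebra_simps)

lemma bv_scaled_discr: "unif_bv K scaled_discr"
proof -
  have "unif_bv K (\<lambda>j z. (residual 1 1 j z - residual 2 2 j z) * (residual 1 1 j z - residual 2 2 j z)
      + 4 * (residual 1 2 j z * residual 2 1 j z))"
    by (intro unif_bv_add unif_bv_mult unif_bv_diff unif_bv_cmult bv_residual)
  then show ?thesis
    by (simp add: scaled_discr_def[abs_def] power2_eq_square mult.assoc)
qed

lemma residual_small:
  assumes "e > 0"
  shows "\<forall>\<^sub>F j in sequentially. \<forall>z\<in>K. cmod (residual k l j z / of_real (scale j)) \<le> e"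
proof -
  obtain C where C: "C > 0" "\<forall>\<^sub>F j in sequentially. \<forall>z\<in>K. cmod (residual k l j z) \<le> C"
    by (rule unif_bvE[OF bv_residual], rule that)
  have "\<forall>\<^sub>F j in sequentially. C / e \<le> scale j"
    using scale_at_top unfolding filterlim_at_top by blast
  then show ?thesis
    using C(2)
  proof eventually_elim
    case (elim j)
    show ?case
    proof
      fix z assume "z \<in> K"
      then have "cmod (residual k l j z) \<le> e * scale j"
        using elim assms by (force simp: field_simps)
      then show "cmod (residual k l j z / of_real (scale j)) \<le> e"
        using scale_pos[of j] by (simp add: norm_divide field_simps)
    qed
  qed
qed

text \<open>In the upper half-plane the upper right entry of \<open>R\<^sub>j\<close> stays away from \<open>0\<close>: in the
Christoffel-Darboux identity for a full block the right-hand side is at least \<open>Im z\<close>, from the first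
summand alone, while the left-hand side is at most the modulus of that entry times the lower right
entry of \<open>X\<^sub>j\<^sub>N\<close>, which tends to \<open>\<epsilon>\<close>.\<close>

lemma residual_12_lower_bound:
  assumes "c > 0" "\<And>z. z \<in> K \<Longrightarrow> c \<le> Im z"
  shows "\<forall>\<^sub>F j in sequentially. \<forall>z\<in>K. c / 2 \<le> cmod (residual 1 2 j z)"
  using residual_small[of 1 2 2, OF zero_less_one]
proof eventually_elim
  case (elim j)
  show ?case
  proof
    fix z assume z: "z \<in> K"
    then have Im: "0 < Im z" "c \<le> Im z" using assms by force+
    let ?p = "partial j N z $ 2 $ 2" and ?q = "partial j N z $ 1 $ 2"
    have "1 \<le> (\<Sum>k<N. (cmod (partial j k z $ 2 $ 2))\<^sup>2)"
      using member_le_sum[of 0 "{..<N}" "\<lambda>k. (cmod (partial j k z $ 2 $ 2))\<^sup>2"] N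
      by (simp add: partial_simps mat_def)
    then have "Im z \<le> scale j * Im (?p * cnj ?q)"
      using Christoffel_Darboux[of j N z] Im(1) unfolding prev_period by simp
    also have "\<dots> \<le> scale j * (cmod ?p * cmod ?q)"
      using order_trans[OF abs_ge_self abs_Im_le_cmod[of "?p * cnj ?q"]] scale_pos[of j]
      by (intro mult_left_mono) (simp_all add: norm_mult)
    also have "\<dots> = cmod ?p * cmod (residual 1 2 j z)"
      using scale_pos[of j] by (simp add: residual_def partial0_N_nth norm_mult)
    also have "\<dots> \<le> 2 * cmod (residual 1 2 j z)"
    proof (rule mult_right_mono)
      have "cmod ?p \<le> cmod (of_real \<epsilon> :: complex) + cmod (residual 2 2 j z / of_real (scale j))"
        unfolding partial_N_nth[of j z 2 2] by (simp add: norm_triangle_ineq del: norm_of_real)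
      moreover have "cmod (of_real \<epsilon> :: complex) = 1" using \<epsilon> by auto
      ultimately show "cmod ?p \<le> 2" using elim z by force
    qed simp
    finally show "c / 2 \<le> cmod (residual 1 2 j z)" using Im(2) by simp
  qed
qed

text \<open>The eigenvalues with the branch prescribed by \<open>xi\<close>. As \<open>det X\<^sub>j\<^sub>N > 0\<close> and \<open>tr X\<^sub>j\<^sub>N \<rightarrow> 2 \<epsilon>\<close>, the argument \<open>w\<close> of
\<open>xi\<close> lies in the half-plane \<open>\<epsilon> Re w > 0\<close>, where the sign rule for \<open>\<surd>(w - 1) \<surd>(w + 1)\<close> identifies
this product, up to positive factors, with \<open>\<epsilon>\<close> times the principal root of the scaled discriminant.\<close>

lemma eigenval_eq:
  assumes "c > 0" "\<forall>\<^sub>F j in sequentially. \<forall>z\<in>K. c \<le> Re (csqrt (scaled_discr j z))"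
  shows "\<forall>\<^sub>F j in sequentially. \<forall>z\<in>K. eigenval a b N s j z
     = of_real \<epsilon> + (residual 1 1 j z + residual 2 2 j z) / of_real (2 * scale j)
        + s * (of_real \<epsilon> * csqrt (scaled_discr j z) / of_real (2 * scale j))"
proof -
  have half: "(1/2 :: real) > 0" by simp
  show ?thesis
    using assms(2) residual_small[of "1/2" 1 1, OF half] residual_small[of "1/2" 2 2, OF half]
  proof eventually_elim
    case (elim j)
    show ?case
    proof
      fix z assume z: "z \<in> K"
      \<comment> \<open>\<open>d\<close> is the determinant of the monodromy matrix and \<open>\<sigma>\<close> its root; \<open>g\<close> is the product of roots in \<open>xi\<close>.\<close>
      define d where "d = prev (j * N) / prev (j * N + N)"
      define \<sigma> where "\<sigma> = complex_of_real (sqrt d)"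
      define Y where "Y = partial j N z"
      define w where "w = trace Y / (2 * \<sigma>)"
      define g where "g = csqrt (w - 1) * csqrt (w + 1)"
      define e where "e = complex_of_real \<epsilon>"
      define A where "A = complex_of_real (scale j)"
      have d: "d > 0" by (simp add: d_def prev_pos)
      have detY: "det Y = of_real d" by (simp add: Y_def det_partial d_def)
      have \<sigma>: "csqrt (det Y) = \<sigma>"
        unfolding detY \<sigma>_def using d by (intro csqrt_unique) (auto simp flip: of_real_power)
      have \<sigma>0: "\<sigma> \<noteq> 0" "\<sigma>\<^sup>2 = det Y"
        using d by (auto simp: \<sigma>_def detY simp flip: of_real_power)
      have A0: "A \<noteq> 0" using scale_pos[of j] by (simp add: A_def)
      have e2: "e * e = 1" using \<epsilon> by (auto simp: e_def)
      have tr: "trace Y = 2 * e + (residual 1 1 j z + residual 2 2 j z) / A"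
        by (simp add: trace_def sum_2 Y_def partial_N_nth e_def A_def add_divide_distrib)
      have tr2: "2 * \<sigma> * w = trace Y" using \<sigma>0 by (simp add: w_def)
      have g2: "g\<^sup>2 = w\<^sup>2 - 1"
        by (simp add: g_def power_mult_distrib algebra_simps power2_eq_square[of w])
      have "(2 * \<sigma> * g)\<^sup>2 = (2 * \<sigma> * w)\<^sup>2 - 4 * \<sigma>\<^sup>2"
        unfolding power_mult_distrib g2 by (simp add: algebra_simps)
      then have "(2 * \<sigma> * g)\<^sup>2 = discr Y"
        unfolding tr2 \<sigma>0(2) discr_def by simp
      then have sq: "(e * (A * (2 * \<sigma> * g)))\<^sup>2 = scaled_discr j z"
        using e2 by (simp add: power_mult_distrib scaled_discr_eq Y_def A_def power2_eq_square[of e])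
      have "e * trace Y = 2 * (e * e) + e * (residual 1 1 j z / A) + e * (residual 2 2 j z / A)"
        unfolding tr by (simp add: algebra_simps add_divide_distrib)
      then have "Re (e * trace Y) = 2 + Re (e * (residual 1 1 j z / A)) + Re (e * (residual 2 2 j z / A))"
        unfolding e2 by simp
      moreover have "cmod (e * (residual 1 1 j z / A)) \<le> 1/2" "cmod (e * (residual 2 2 j z / A)) \<le> 1/2"
        using elim(2,3) z \<epsilon> by (auto simp: e_def A_def norm_mult)
      ultimately have "Re (e * trace Y) > 0"
        using abs_Re_le_cmod[of "e * (residual 1 1 j z / A)"] abs_Re_le_cmod[of "e * (residual 2 2 j z / A)"]
        by linarith
      then have "0 < \<epsilon> * Re (2 * \<sigma> * w)" unfolding tr2 e_def by simp
      then have "0 < 2 * sqrt d * (\<epsilon> * Re w)" unfolding \<sigma>_def by (simp add: mult_ac)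
      then have rw: "0 < \<epsilon> * Re w" using d by (simp add: zero_less_mult_iff)
      have "0 \<le> Re w * Re g" unfolding g_def by (rule Re_csqrt_mult_sign)
      then have "0 \<le> (\<epsilon> * Re w) * (\<epsilon> * Re g)" using \<epsilon> by auto
      then have "0 \<le> \<epsilon> * Re g" using rw by (simp add: zero_le_mult_iff)
      then have "0 \<le> (scale j * 2 * sqrt d) * (\<epsilon> * Re g)" using d scale_pos[of j] by simp
      then have nn: "0 \<le> Re (e * (A * (2 * \<sigma> * g)))" unfolding e_def A_def \<sigma>_def by (simp add: mult_ac)
      have "scaled_discr j z \<notin> \<real>\<^sub>\<le>\<^sub>0"
        using elim(1) z assms(1) unfolding Re_csqrt_pos_iff[symmetric] by force
      then have "Re (e * (A * (2 * \<sigma> * g))) \<noteq> 0"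
        unfolding sq[symmetric] by (auto simp: complex_nonpos_Reals_iff Re_power2 Im_power2)
      then have root: "csqrt (scaled_discr j z) = e * (A * (2 * \<sigma> * g))"
        using nn by (intro csqrt_unique sq) auto
      have "\<sigma> * g = e * csqrt (scaled_discr j z) / (2 * A)"
        unfolding root using A0 e2 by (simp add: mult.assoc[symmetric])
      moreover have "\<sigma> * w = e + (residual 1 1 j z + residual 2 2 j z) / (2 * A)"
        using arg_cong[OF tr2, of "\<lambda>x. x / 2"] unfolding tr by (simp add: add_divide_distrib mult.commute)
      moreover have "eigenval a b N s j z = \<sigma> * w + s * (\<sigma> * g)"
        unfolding eigenval_def monodromy_eq_partial Y_def[symmetric] Let_def \<sigma> w_def[symmetric]
          xi_def g_def[symmetric] by (simp add: algebra_simps)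
      ultimately show "eigenval a b N s j z
        = of_real \<epsilon> + (residual 1 1 j z + residual 2 2 j z) / of_real (2 * scale j)
          + s * (of_real \<epsilon> * csqrt (scaled_discr j z) / of_real (2 * scale j))"
        by (simp add: e_def A_def)
    qed
  qed
qed

text \<open>On the compact set \<open>K\<close> the continuous function \<open>Re \<surd>h\<close> has a positive minimum, and uniform
convergence passes half of it on to the scaled discriminants.\<close>

lemma csqrt_scaled_discr_lower_bound:
  assumes "\<And>z. z \<in> K \<Longrightarrow> limit_discr a b N z \<notin> \<real>\<^sub>\<le>\<^sub>0"
  shows "\<exists>c>0. \<forall>\<^sub>F j in sequentially. \<forall>z\<in>K. c \<le> Re (csqrt (scaled_discr j z))"
proof -
  obtain h where h: "uniform_limit K scaled_discr h sequentially"
    using bv_scaled_discr by (rule unif_bv_uniform_limit)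
  have eq: "limit_discr a b N z = h z" if "z \<in> K" for z
    using tendsto_uniform_limitI[OF h that]
    unfolding limit_discr_def monodromy_eq_partial scaled_discr_eq scale_def by (rule limI)
  have "regular_on K (scaled_discr j)" for j
    unfolding scaled_discr_def power2_eq_square by (intro regular_on_intros regular_residual)
  then have "regular_on K h" by (rule regular_on_uniform_limit[OF h])
  then have "regular_on K (\<lambda>z. csqrt (h z))"
    by (rule regular_on_csqrt) (use assms eq in auto)
  then have cont: "continuous_on K (\<lambda>z. Re (csqrt (h z)))"
    unfolding regular_on_def by (intro continuous_intros) auto
  obtain c where c: "c > 0" "\<And>z. z \<in> K \<Longrightarrow> 2 * c \<le> Re (csqrt (h z))"
  proof (cases "K = {}")
    case True
    then show ?thesis using that[of 1] by simp
  next
    case False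
    obtain z0 where z0: "z0 \<in> K" "\<And>z. z \<in> K \<Longrightarrow> Re (csqrt (h z0)) \<le> Re (csqrt (h z))"
      using continuous_attains_inf[OF K False cont] by blast
    have "0 < Re (csqrt (h z0))"
      unfolding Re_csqrt_pos_iff using assms[OF z0(1)] eq[OF z0(1)] by simp
    then show ?thesis using that[of "Re (csqrt (h z0)) / 2"] z0(2) by simp
  qed
  have "\<forall>\<^sub>F j in sequentially. \<forall>z\<in>K. dist (scaled_discr j z) (h z) < 2 * c * c"
    using h c(1) by (intro uniform_limitD) auto
  then have "\<forall>\<^sub>F j in sequentially. \<forall>z\<in>K. c \<le> Re (csqrt (scaled_discr j z))"
  proof eventually_elim
    case (elim j)
    show ?case
    proof
      fix z assume z: "z \<in> K"
      have "cmod (csqrt (h z) - csqrt (scaled_discr j z)) \<le> cmod (h z - scaled_discr j z) / (2 * c)"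
        using c z by (intro csqrt_diff_le) auto
      also have "\<dots> \<le> (2 * c * c) / (2 * c)"
        using elim z c(1) by (intro divide_right_mono) (auto simp: dist_norm norm_minus_commute less_imp_le)
      also have "\<dots> = c" using c(1) by simp
      finally have "Re (csqrt (h z) - csqrt (scaled_discr j z)) \<le> c"
        by (meson complex_Re_le_cmod order_trans)
      then show "c \<le> Re (csqrt (scaled_discr j z))" using c(2)[OF z] by simp
    qed
  qed
  then show ?thesis using c(1) by blast
qed

section \<open>Solutions with prescribed values and their asymptotics inside a block\<close>

text \<open>The solution with value \<open>(w1, w2)\<close> at index \<open>m\<close>. The initial vector is written with the adjugate
matrix so that its regularity in \<open>z\<close> can be read off.\<close>

definition extend :: "nat \<Rightarrow> (complex \<Rightarrow> complex) \<Rightarrow> (complex \<Rightarrow> complex) \<Rightarrow> nat \<Rightarrow> complex \<Rightarrow> complex^2" where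
  "extend m w1 w2 n z = partial 0 n z *v
     (let F = partial 0 m z in
      vector [(F $ 2 $ 2 * w1 z - F $ 1 $ 2 * w2 z) / det F, (F $ 1 $ 1 * w2 z - F $ 2 $ 1 * w1 z) / det F])"

lemma det_partial_nonzero: "det (partial j i z) \<noteq> 0"
  using prev_pos[of "j * N"] prev_pos[of "j * N + i"] by (simp add: det_partial)

lemma extend_at: "extend m w1 w2 m z $ 1 = w1 z" "extend m w1 w2 m z $ 2 = w2 z"
proof -
  define F where "F = partial 0 m z"
  have F: "det F \<noteq> 0" by (simp add: F_def det_partial_nonzero)
  have eq: "p * (x / det F) + q * (y / det F) = (p * x + q * y) / det F" for p q x y
    by (simp add: add_divide_distrib)
  have "extend m w1 w2 m z $ 1 = (det F * w1 z) / det F"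
    "extend m w1 w2 m z $ 2 = (det F * w2 z) / det F"
    unfolding extend_def F_def[symmetric] Let_def matrix_vector_mult_nth_2 vector_2 eq
    by (simp_all add: det_2 algebra_simps)
  then show "extend m w1 w2 m z $ 1 = w1 z" "extend m w1 w2 m z $ 2 = w2 z"
    using F by simp_all
qed

lemma extend_Suc: "extend m w1 w2 (Suc n) z = transfer a b n z *v extend m w1 w2 n z"
  by (simp add: extend_def partial_simps matrix_vector_mul_assoc)

lemma regular_extend:
  assumes "regular_on K w1" "regular_on K w2"
  shows "regular_on K (\<lambda>z. extend m w1 w2 n z $ k)"
  unfolding extend_def Let_def matrix_vector_mult_nth_2 vector_2
  by (intro regular_on_intros regular_on_divide assms regular_partial det_partial_nonzero)
    (simp_all add: det_2 regular_on_intros regular_partial)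

lemma solution_block:
  fixes W :: "nat \<Rightarrow> complex^2"
  assumes "\<And>n. W (Suc n) = transfer a b n z *v W n"
  shows "W (k * N + i) = partial k i z *v W (k * N)"
  by (induction i) (simp_all add: partial_simps assms matrix_vector_mul_assoc)

lemma solution_gen_eigenvector:
  fixes W :: "nat \<Rightarrow> complex^2"
  assumes W: "\<And>n. W (Suc n) = transfer a b n z *v W n" and "W n \<noteq> 0"
  shows "gen_eigenvector a b z (\<lambda>n. W n $ 2)"
  unfolding gen_eigenvector_def Let_def
proof (intro exI conjI allI)
  show "W 0 \<noteq> 0"
  proof
    assume "W 0 = 0"
    then have "W n = 0" for n by (induction n) (simp_all add: W)
    then show False using assms(2) by simp
  qed
  have first: "W (Suc n) $ 1 = W n $ 2" for n
    unfolding W matrix_vector_mult_nth_2 transfer_nth by simp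
  have eq: "(if n = 0 then W 0 else vector [W (n - 1) $ 2, W n $ 2]) = W n" for n
  proof (cases n)
    case (Suc m)
    then show ?thesis by (simp add: vec_eq_iff forall_2 first)
  qed simp
  show "(if Suc n = 0 then W 0 else vector [W (Suc n - 1) $ 2, W (Suc n) $ 2])
    = transfer a b n z *v (if n = 0 then W 0 else vector [W (n - 1) $ 2, W n $ 2])" for n
    unfolding eq by (rule W)
qed

lemma transfer_uniform_limit:
  "uniform_limit K (\<lambda>k z. transfer a b (k * N + i) z $ r $ s)
     (\<lambda>z. transfer_periodic \<alpha> \<beta> (int i) 0 $ r $ s) sequentially"
proof (rule unif_bv_tendsto_imp_uniform_limit[OF bv_transfer])
  fix z assume "z \<in> K"
  have "filterlim a at_top sequentially" using modulated by (simp add: periodically_modulated_def)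
  then have inv: "(\<lambda>k. inverse (a (k * N + i))) \<longlonglongrightarrow> 0"
    by (intro tendsto_inverse_0_at_top) (rule filterlim_compose[OF _ filterlim_block_index])
  have "(\<lambda>n. b n / a n - \<beta> (int n) / \<alpha> (int n)) \<longlonglongrightarrow> 0"
    using modulated by (simp add: periodically_modulated_def)
  then have "(\<lambda>k. b (k * N + i) / a (k * N + i) - \<beta> (int (k * N + i)) / \<alpha> (int (k * N + i))) \<longlonglongrightarrow> 0"
    by (rule filterlim_compose[OF _ filterlim_block_index])
  then have "(\<lambda>k. b (k * N + i) / a (k * N + i)) \<longlonglongrightarrow> \<beta> (int i) / \<alpha> (int i)"
    unfolding periodic_index by (simp only: LIM_zero_iff)
  from tendsto_diff[OF tendsto_mult[OF tendsto_const tendsto_of_real[OF inv]] tendsto_of_real[OF this]]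
  have "(\<lambda>k. z * of_real (inverse (a (k * N + i))) - of_real (b (k * N + i) / a (k * N + i)))
      \<longlonglongrightarrow> z * of_real 0 - of_real (\<beta> (int i) / \<alpha> (int i))" .
  then have 22: "(\<lambda>k. transfer a b (k * N + i) z $ 2 $ 2) \<longlonglongrightarrow> transfer_periodic \<alpha> \<beta> (int i) 0 $ 2 $ 2"
    by (simp add: transfer_nth transfer_periodic_nth divide_inverse left_diff_distrib)
  have "(\<lambda>k. - of_real (prev (k * N + i) / a (k * N + i)) :: complex)
      \<longlonglongrightarrow> - of_real (\<alpha> (int i - 1) / \<alpha> (int i))"
    by (intro tendsto_intros prev_ratio_tendsto)
  then have 21: "(\<lambda>k. transfer a b (k * N + i) z $ 2 $ 1) \<longlonglongrightarrow> transfer_periodic \<alpha> \<beta> (int i) 0 $ 2 $ 1"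
    unfolding transfer_nth transfer_periodic_nth prev_def .
  have 1: "(\<lambda>k. transfer a b (k * N + i) z $ 1 $ s) \<longlonglongrightarrow> transfer_periodic \<alpha> \<beta> (int i) 0 $ 1 $ s"
    using exhaust_2[of s] by (auto simp: transfer_nth transfer_periodic_nth)
  consider "r = 1" | "r = 2" "s = 1" | "r = 2" "s = 2"
    using exhaust_2[of r] exhaust_2[of s] by blast
  then show "(\<lambda>k. transfer a b (k * N + i) z $ r $ s) \<longlonglongrightarrow> transfer_periodic \<alpha> \<beta> (int i) 0 $ r $ s"
    by cases (simp_all only: 1 21 22)
qed

text \<open>Inside a block the transfer matrices converge uniformly, so the limit at the start of the blocks
determines the limits at all other positions.\<close>

lemma block_asymptotics:
  fixes W :: "nat \<Rightarrow> complex \<Rightarrow> complex^2"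
  assumes W: "\<And>n z. W (Suc n) z = transfer a b n z *v W n z"
    and f: "uniform_limit K (\<lambda>k z. W (k * N) z $ 1 / \<Lambda> k z) f1 sequentially"
      "uniform_limit K (\<lambda>k z. W (k * N) z $ 2 / \<Lambda> k z) f2 sequentially"
      "bounded (f1 ` K)" "bounded (f2 ` K)"
  shows "uniform_limit K (\<lambda>k z. W (k * N + i) z $ r / \<Lambda> k z)
       (\<lambda>z. (partial0 i *v vector [f1 z, f2 z]) $ r) sequentially \<and>
     bounded ((\<lambda>z. (partial0 i *v vector [f1 z, f2 z]) $ r) ` K)"
proof (induction i arbitrary: r)
  case 0
  show ?case using exhaust_2[of r] f by (auto simp: partial0_simps)
next
  case (Suc i)
  let ?\<phi> = "\<lambda>s z. (partial0 i *v vector [f1 z, f2 z]) $ s"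
  let ?T = "transfer_periodic \<alpha> \<beta> (int i) 0"
  have \<phi>: "(partial0 (Suc i) *v vector [f1 z, f2 z]) $ r = ?T $ r $ 1 * ?\<phi> 1 z + ?T $ r $ 2 * ?\<phi> 2 z" for z
    unfolding partial0_simps matrix_vector_mul_assoc[symmetric] matrix_vector_mult_nth_2[of ?T] ..
  have eq: "W (k * N + Suc i) z $ r / \<Lambda> k z
      = transfer a b (k * N + i) z $ r $ 1 * (W (k * N + i) z $ 1 / \<Lambda> k z)
      + transfer a b (k * N + i) z $ r $ 2 * (W (k * N + i) z $ 2 / \<Lambda> k z)" for k z
    by (simp add: W matrix_vector_mult_nth_2 add_divide_distrib)
  have bT: "bounded ((\<lambda>z. ?T $ r $ s) ` K)" for s
    by (auto simp: bounded_iff)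
  show ?case unfolding \<phi> eq
    using Suc by (intro conjI uniform_limit_add uniform_lim_mult transfer_uniform_limit bT
        bounded_plus_comp bounded_image_mult) auto
qed

lemma partial0_nonzero:
  assumes "x \<noteq> 0"
  shows "partial0 i *v x \<noteq> 0"
proof (induction i)
  case 0
  show ?case using assms by (simp add: partial0_simps)
next
  case (Suc i)
  have "v = 0" if "transfer_periodic \<alpha> \<beta> (int i) 0 *v v = 0" for v
  proof -
    have "v $ 2 = 0" "- of_real (\<alpha> (int i - 1) / \<alpha> (int i)) * v $ 1 = 0"
      using arg_cong[OF that, of "\<lambda>x :: complex^2. x $ 1"] arg_cong[OF that, of "\<lambda>x :: complex^2. x $ 2"]
      by (simp_all add: matrix_vector_mult_nth_2 transfer_periodic_nth)
    then show ?thesis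
      using \<alpha>_pos[of "int i"] \<alpha>_pos[of "int i - 1"] by (simp add: vec_eq_iff forall_2)
  qed
  then show ?case
    using Suc by (auto simp: partial0_simps matrix_vector_mul_assoc[symmetric])
qed

text \<open>The two numbers are the entries of one vector, the image of \<open>x\<close> under an invertible matrix.\<close>

lemma partial0_consecutive:
  assumes "x \<noteq> 0"
  shows "0 < cmod ((partial0 i *v x) $ 2) + cmod ((partial0 (i + 1) *v x) $ 2)"
proof -
  have "(partial0 (Suc i) *v x) $ 1 = (partial0 i *v x) $ 2"
    unfolding partial0_simps matrix_vector_mul_assoc[symmetric] matrix_vector_mult_nth_2[of "transfer_periodic _ _ _ _"]
    by (simp add: transfer_periodic_nth)
  moreover have "partial0 (Suc i) *v x \<noteq> 0" using assms by (rule partial0_nonzero)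
  ultimately have "(partial0 i *v x) $ 2 \<noteq> 0 \<or> (partial0 (Suc i) *v x) $ 2 \<noteq> 0"
    by (auto simp: vec_eq_iff forall_2)
  then show ?thesis by (auto intro: add_pos_nonneg add_nonneg_pos)
qed

text \<open>The Levinson theorem yields solutions of the block recurrence from index \<open>M\<close> on; they are the
restrictions of full solutions to the block boundaries.\<close>

lemma extend_follows:
  assumes "\<And>n. n \<ge> M \<Longrightarrow>
        p1 (Suc n) z = partial n N z $ 1 $ 1 * p1 n z + partial n N z $ 1 $ 2 * p2 n z \<and>
        p2 (Suc n) z = partial n N z $ 2 $ 1 * p1 n z + partial n N z $ 2 $ 2 * p2 n z"
    and "k \<ge> M"
  shows "extend (M * N) (p1 M) (p2 M) (k * N) z $ 1 = p1 k z \<and>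
    extend (M * N) (p1 M) (p2 M) (k * N) z $ 2 = p2 k z"
  using assms(2)
proof (induction k rule: dec_induct)
  case base
  show ?case by (simp add: extend_at)
next
  case (step n)
  let ?W = "\<lambda>k. extend (M * N) (p1 M) (p2 M) k z"
  have "?W (Suc n * N) = ?W (n * N + N)" by (simp add: add.commute)
  also have "\<dots> = partial n N z *v ?W (n * N)"
    by (rule solution_block) (rule extend_Suc)
  finally show ?case
    using step assms(1)[of n] by (simp add: matrix_vector_mult_nth_2)
qed

lemma lin_indep_solutions:
  fixes W V :: "nat \<Rightarrow> complex^2"
  assumes W: "\<And>n. W (Suc n) = transfer a b n z *v W n" "\<And>n. V (Suc n) = transfer a b n z *v V n"
    and n: "n \<ge> 1" "W n $ 1 * V n $ 2 \<noteq> W n $ 2 * V n $ 1"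
  shows "lin_indep_seqs (\<lambda>n. W n $ 2) (\<lambda>n. V n $ 2)"
  unfolding lin_indep_seqs_def
proof (intro allI impI)
  fix c d assume *: "\<forall>n. c * W n $ 2 + d * V n $ 2 = 0"
  obtain m where m: "n = Suc m" using n(1) by (cases n) auto
  have "W n $ 1 = W m $ 2" "V n $ 1 = V m $ 2"
    unfolding m W matrix_vector_mult_nth_2 transfer_nth by simp_all
  then have 1: "c * W n $ 1 + d * V n $ 1 = 0" and 2: "c * W n $ 2 + d * V n $ 2 = 0"
    using * by simp_all
  have "c * (W n $ 1 * V n $ 2 - W n $ 2 * V n $ 1)
      = (c * W n $ 1 + d * V n $ 1) * V n $ 2 - (c * W n $ 2 + d * V n $ 2) * V n $ 1"
    "d * (W n $ 1 * V n $ 2 - W n $ 2 * V n $ 1)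
      = (c * W n $ 2 + d * V n $ 2) * W n $ 1 - (c * W n $ 1 + d * V n $ 1) * W n $ 2"
    by (simp_all add: algebra_simps)
  then show "c = 0 \<and> d = 0" unfolding 1 2 using n(2) by simp
qed

end

section \<open>Asymptotics of the generalized eigenvectors\<close>

theorem theorem6p3:
  fixes N :: nat and a b :: "nat \<Rightarrow> real" and \<alpha> \<beta> :: "int \<Rightarrow> real"
    and \<epsilon> :: real and K :: "complex set"
  assumes "N \<ge> 1"
    and "\<And>n. a n > 0"
    and "periodically_modulated N \<alpha> \<beta> a b"
    and "\<epsilon> \<in> {-1, 1}"
    and "monodromy_periodic \<alpha> \<beta> N 0 0 = \<epsilon> *\<^sub>R mat 1"
    and "bounded_variation_class N
           (\<lambda>n. a (Suc n) * (\<alpha> (int n) / \<alpha> (int (Suc n)) - a n / a (Suc n)))"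
    and "bounded_variation_class N (\<lambda>n. a n * (\<beta> (int n) / \<alpha> (int n) - b n / a n))"
    and "bounded_variation_class N (\<lambda>n. 1 / a n)"
    and "compact K"
    and "K \<subseteq> {z. Im z > 0 \<and> limit_discr a b N z \<notin> \<real>\<^sub>\<le>\<^sub>0 \<and>
                 \<epsilon> * Re (deriv (limit_discr a b N) z) > 0}"
  shows "\<exists>M\<ge>1. \<exists>u_plus u_minus :: nat \<Rightarrow> complex \<Rightarrow> complex.
           gen_eigenvector_basis_on a b K u_plus u_minus \<and>
           (\<forall>n. continuous_on K (u_plus n) \<and> continuous_on K (u_minus n)) \<and>
           (\<forall>n. u_plus n holomorphic_on interior K \<and> u_minus n holomorphic_on interior K) \<and>
           (\<exists>\<phi>_plus \<phi>_minus :: nat \<Rightarrow> complex \<Rightarrow> complex.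
              (\<forall>i. uniform_limit K
                     (\<lambda>k z. u_plus (k * N + i) z / (\<Prod>j\<in>{M..<k}. eigenval a b N 1 j z))
                     (\<phi>_plus i) sequentially \<and>
                   uniform_limit K
                     (\<lambda>k z. u_minus (k * N + i) z / (\<Prod>j\<in>{M..<k}. eigenval a b N (-1) j z))
                     (\<phi>_minus i) sequentially) \<and>
              (\<forall>z\<in>K. \<forall>i\<in>{0..N - 1}.
                 cmod (\<phi>_plus i z) + cmod (\<phi>_plus (i + 1) z) > 0 \<and>
                 cmod (\<phi>_minus i z) + cmod (\<phi>_minus (i + 1) z) > 0))"
proof -
  interpret modulated_parameters N a b \<alpha> \<beta> \<epsilon> K
    using assms(1-9) by unfold_locales
  let ?lp = "eigenval a b N 1" and ?lm = "eigenval a b N (-1)"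
  obtain c1 where c1: "c1 > 0" "\<forall>\<^sub>F j in sequentially. \<forall>z\<in>K. c1 \<le> Re (csqrt (scaled_discr j z))"
    using csqrt_scaled_discr_lower_bound assms(10) by blast
  obtain c2 where c2: "c2 > 0" "\<And>z. z \<in> K \<Longrightarrow> c2 \<le> Im z"
  proof (cases "K = {}")
    case True
    then show ?thesis using that[of 1] by simp
  next
    case False
    obtain z0 where "z0 \<in> K" "\<And>z. z \<in> K \<Longrightarrow> Im z0 \<le> Im z"
      using continuous_attains_inf[OF assms(9) False continuous_on_Im[OF continuous_on_id]] by auto
    then show ?thesis using that[of "Im z0"] assms(10) by auto
  qed
  define c where "c = min c1 (c2 / 2)"
  have c: "c > 0" using c1(1) c2(1) by (simp add: c_def)
  have "\<forall>\<^sub>F j in sequentially. \<forall>z\<in>K. c2 / 2 \<le> cmod (residual 1 2 j z)"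
    by (rule residual_12_lower_bound[OF c2(1)]) (rule c2(2))
  then have r12: "\<forall>\<^sub>F j in sequentially. \<forall>z\<in>K. c \<le> cmod (residual 1 2 j z)"
    by eventually_elim (auto simp: c_def min_le_iff_disj)
  have H: "\<forall>\<^sub>F j in sequentially. \<forall>z\<in>K. c \<le> Re (csqrt (scaled_discr j z))"
    using c1(2) by eventually_elim (auto simp: c_def min_le_iff_disj)
  have lp: "\<forall>\<^sub>F j in sequentially. \<forall>z\<in>K. ?lp j z = of_real \<epsilon>
      + (residual 1 1 j z + residual 2 2 j z) / of_real (2 * scale j)
      + of_real \<epsilon> * csqrt (scaled_discr j z) / of_real (2 * scale j)"
    using eigenval_eq[OF c1, of 1] by simp
  have lm: "\<forall>\<^sub>F j in sequentially. \<forall>z\<in>K. ?lm j z = of_real \<epsilon>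
      + (residual 1 1 j z + residual 2 2 j z) / of_real (2 * scale j)
      - of_real \<epsilon> * csqrt (scaled_discr j z) / of_real (2 * scale j)"
    using eigenval_eq[OF c1, of "-1"] by simp
  obtain M p1 p2 q1 q2 f1 f2 g1 g2 where M: "M \<ge> 1"
    and rec: "\<forall>n\<ge>M. \<forall>z\<in>K. ?lp n z \<noteq> 0 \<and> ?lm n z \<noteq> 0 \<and>
        p1 (Suc n) z = (of_real \<epsilon> + residual 1 1 n z / of_real (scale n)) * p1 n z + residual 1 2 n z / of_real (scale n) * p2 n z \<and>
        p2 (Suc n) z = residual 2 1 n z / of_real (scale n) * p1 n z + (of_real \<epsilon> + residual 2 2 n z / of_real (scale n)) * p2 n z \<and>
        q1 (Suc n) z = (of_real \<epsilon> + residual 1 1 n z / of_real (scale n)) * q1 n z + residual 1 2 n z / of_real (scale n) * q2 n z \<and>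
        q2 (Suc n) z = residual 2 1 n z / of_real (scale n) * q1 n z + (of_real \<epsilon> + residual 2 2 n z / of_real (scale n)) * q2 n z"
    and reg: "regular_on K (p1 M)" "regular_on K (p2 M)" "regular_on K (q1 M)" "regular_on K (q2 M)"
    and lim: "uniform_limit K (\<lambda>n z. p1 n z / (\<Prod>j\<in>{M..<n}. ?lp j z)) f1 sequentially"
      "uniform_limit K (\<lambda>n z. p2 n z / (\<Prod>j\<in>{M..<n}. ?lp j z)) f2 sequentially"
      "uniform_limit K (\<lambda>n z. q1 n z / (\<Prod>j\<in>{M..<n}. ?lm j z)) g1 sequentially"
      "uniform_limit K (\<lambda>n z. q2 n z / (\<Prod>j\<in>{M..<n}. ?lm j z)) g2 sequentially"
    and bdd: "bounded (f1 ` K)" "bounded (f2 ` K)" "bounded (g1 ` K)" "bounded (g2 ` K)"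
    and det: "\<forall>z\<in>K. f1 z * g2 z \<noteq> f2 z * g1 z"
    using discrete_Levinson[OF \<epsilon> scale_pos scale_at_top bv_residual bv_residual bv_residual bv_residual
        regular_residual regular_residual regular_residual regular_residual c r12
        H[unfolded scaled_discr_def] lp[unfolded scaled_discr_def] lm[unfolded scaled_discr_def]]
    by (elim exE conjE) (rule that)
  define W where "W = extend (M * N) (p1 M) (p2 M)"
  define V where "V = extend (M * N) (q1 M) (q2 M)"
  have WV: "W (Suc n) z = transfer a b n z *v W n z" "V (Suc n) z = transfer a b n z *v V n z" for n z
    unfolding W_def V_def by (rule extend_Suc)+
  have Wp: "W (k * N) z $ 1 = p1 k z \<and> W (k * N) z $ 2 = p2 k z" if "k \<ge> M" "z \<in> K" for k z
    unfolding W_def using rec that by (intro extend_follows) (simp_all add: partial_N_nth)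
  have Vq: "V (k * N) z $ 1 = q1 k z \<and> V (k * N) z $ 2 = q2 k z" if "k \<ge> M" "z \<in> K" for k z
    unfolding V_def using rec that by (intro extend_follows) (simp_all add: partial_N_nth)
  have transfer_lim: "uniform_limit K (\<lambda>k z. X (k * N) z $ r / \<Lambda> k z) f sequentially"
    if "uniform_limit K (\<lambda>k z. x k z / \<Lambda> k z) f sequentially"
      "\<And>k z. k \<ge> M \<Longrightarrow> z \<in> K \<Longrightarrow> X (k * N) z $ r = x k z"
    for X :: "nat \<Rightarrow> complex \<Rightarrow> complex^2" and x \<Lambda> f r
  proof (rule uniform_limit_cong[THEN iffD1, OF _ _ that(1)])
    show "\<forall>\<^sub>F k in sequentially. \<forall>z\<in>K. x k z / \<Lambda> k z = X (k * N) z $ r / \<Lambda> k z"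
      using eventually_ge_at_top[of M] by eventually_elim (simp add: that(2))
  qed simp
  have Wlim: "uniform_limit K (\<lambda>k z. W (k * N) z $ 1 / (\<Prod>j\<in>{M..<k}. ?lp j z)) f1 sequentially"
    "uniform_limit K (\<lambda>k z. W (k * N) z $ 2 / (\<Prod>j\<in>{M..<k}. ?lp j z)) f2 sequentially"
    using Wp by (auto intro!: transfer_lim[OF lim(1)] transfer_lim[OF lim(2)])
  have Vlim: "uniform_limit K (\<lambda>k z. V (k * N) z $ 1 / (\<Prod>j\<in>{M..<k}. ?lm j z)) g1 sequentially"
    "uniform_limit K (\<lambda>k z. V (k * N) z $ 2 / (\<Prod>j\<in>{M..<k}. ?lm j z)) g2 sequentially"
    using Vq by (auto intro!: transfer_lim[OF lim(3)] transfer_lim[OF lim(4)])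
  \<comment> \<open>The normalised values at the block boundaries have a nonzero limiting determinant.\<close>
  have indep: "\<exists>n\<ge>1. W n z $ 1 * V n z $ 2 \<noteq> W n z $ 2 * V n z $ 1" if z: "z \<in> K" for z
  proof -
    let ?P = "\<lambda>k. \<Prod>j\<in>{M..<k}. ?lp j z" and ?Q = "\<lambda>k. \<Prod>j\<in>{M..<k}. ?lm j z"
    have "(\<lambda>k. (W (k * N) z $ 1 / ?P k) * (V (k * N) z $ 2 / ?Q k)
        - (W (k * N) z $ 2 / ?P k) * (V (k * N) z $ 1 / ?Q k)) \<longlonglongrightarrow> f1 z * g2 z - f2 z * g1 z"
      by (intro tendsto_intros tendsto_uniform_limitI[OF Wlim(1) z] tendsto_uniform_limitI[OF Wlim(2) z]
          tendsto_uniform_limitI[OF Vlim(1) z] tendsto_uniform_limitI[OF Vlim(2) z])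
    then have "\<forall>\<^sub>F k in sequentially. (W (k * N) z $ 1 / ?P k) * (V (k * N) z $ 2 / ?Q k)
        - (W (k * N) z $ 2 / ?P k) * (V (k * N) z $ 1 / ?Q k) \<noteq> 0"
      using det z by (intro tendsto_imp_eventually_ne) auto
    then obtain k where k: "k \<ge> 1" "(W (k * N) z $ 1 / ?P k) * (V (k * N) z $ 2 / ?Q k)
        - (W (k * N) z $ 2 / ?P k) * (V (k * N) z $ 1 / ?Q k) \<noteq> 0"
      unfolding eventually_sequentially by (meson le_cases)
    then have "W (k * N) z $ 1 * V (k * N) z $ 2 \<noteq> W (k * N) z $ 2 * V (k * N) z $ 1"
      by (auto simp: field_simps)
    moreover have "k * N \<ge> 1" using k(1) assms(1) by simp
    ultimately show ?thesis by blast
  qed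
  have basis: "gen_eigenvector_basis_on a b K (\<lambda>n z. W n z $ 2) (\<lambda>n z. V n z $ 2)"
    unfolding gen_eigenvector_basis_on_def
  proof (intro ballI conjI)
    fix z assume z: "z \<in> K"
    obtain n where n: "n \<ge> 1" "W n z $ 1 * V n z $ 2 \<noteq> W n z $ 2 * V n z $ 1"
      using indep[OF z] by blast
    have "W n z \<noteq> 0" "V n z \<noteq> 0" using n(2) by auto
    then show "gen_eigenvector a b z (\<lambda>n. W n z $ 2)" "gen_eigenvector a b z (\<lambda>n. V n z $ 2)"
      using WV by (auto intro: solution_gen_eigenvector)
    show "lin_indep_seqs (\<lambda>n. W n z $ 2) (\<lambda>n. V n z $ 2)"
      by (rule lin_indep_solutions[where W = "\<lambda>n. W n z" and V = "\<lambda>n. V n z", OF WV n])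
  qed
  have regWV: "regular_on K (\<lambda>z. W n z $ 2)" "regular_on K (\<lambda>z. V n z $ 2)" for n
    unfolding W_def V_def by (intro regular_extend reg)+
  define \<phi>p where "\<phi>p i z = (partial0 i *v vector [f1 z, f2 z]) $ 2" for i z
  define \<phi>m where "\<phi>m i z = (partial0 i *v vector [g1 z, g2 z]) $ 2" for i z
  have asym: "uniform_limit K (\<lambda>k z. W (k * N + i) z $ 2 / (\<Prod>j\<in>{M..<k}. ?lp j z)) (\<phi>p i) sequentially"
    "uniform_limit K (\<lambda>k z. V (k * N + i) z $ 2 / (\<Prod>j\<in>{M..<k}. ?lm j z)) (\<phi>m i) sequentially" for i
    unfolding \<phi>p_def \<phi>m_def
    using block_asymptotics[OF WV(1) Wlim bdd(1,2)] block_asymptotics[OF WV(2) Vlim bdd(3,4)] by blast+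
  have ne: "(vector [f1 z, f2 z] :: complex^2) \<noteq> 0" "(vector [g1 z, g2 z] :: complex^2) \<noteq> 0" if "z \<in> K" for z
    using det that by (auto simp: vec_eq_iff forall_2)
  have pos: "0 < cmod (\<phi>p i z) + cmod (\<phi>p (i + 1) z)" "0 < cmod (\<phi>m i z) + cmod (\<phi>m (i + 1) z)"
    if "z \<in> K" for i z
    unfolding \<phi>p_def \<phi>m_def by (rule partial0_consecutive[OF ne(1)[OF that]] partial0_consecutive[OF ne(2)[OF that]])+
  show ?thesis
  proof (rule exI[of _ M], rule conjI[OF M], rule exI[of _ "\<lambda>n z. W n z $ 2"], rule exI[of _ "\<lambda>n z. V n z $ 2"],
      rule conjI[OF basis], rule conjI, goal_cases)
    case 1
    show ?case using regWV by (simp add: regular_on_def)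
  next
    case 2
    have "\<forall>n. (\<lambda>z. W n z $ 2) holomorphic_on interior K \<and> (\<lambda>z. V n z $ 2) holomorphic_on interior K"
      using regWV by (simp add: regular_on_def)
    then show ?case
      by (rule conjI) (rule exI[of _ \<phi>p], rule exI[of _ \<phi>m], use asym pos in blast)
  qed
qed

end
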